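(* Let $q$ be an odd prime power, $d\in\mathbb{F}_q^*$, and define $$h(x)=\frac{4x^4-12d^2x^2+8d^3x-d^4}{2x(x-d)(2x-d)}\in\mathbb{F}_q(x).$$ Then the extension $\mathbb{F}_q(x)/\mathbb{F}_q(h(x))$ is Galois and: (i) If $q\equiv3\pmod 4$, then $\#T^1_{split}(h)=\frac{q+1}{4}$, and $h$ is $(3,\frac{q+1}{4})$-good. (ii) If $q\equiv1\pmod 4$, then $\#T^1_{split}(h)=\frac{q-1}{4}$, and $h$ is $(3,\frac{q-1}{4})$-good.
   Context: $\mathbb{P}^1(\mathbb{F}_q)=\mathbb{F}_q\cup\{\infty\}$; a rational function $h=f/g$ ($f,g$ coprime) has degree $\max\{\deg f,\deg g\}$ and induces a map $\mathbb{P}^1(\mathbb{F}_q)\to\mathbb{P}^1(\mathbb{F}_q)$ by evaluation. $h$ is $(r,l)$-good ($l\geq1$) if $\deg(h)=r+1$ and there exist $l$ pairwise disjoint subsets $A_1,\dots,A_l$ of $\mathbb{P}^1(\mathbb{F}_q)$ with $|A_i|=r+1$ and $h(A_i)=\{t_i\}$ for some $t_i\in\mathbb{P}^1(\mathbb{F}_q)$. With $t=h(x)$, $T^1_{split}(h)$ is the set of rational (degree-one) places of $\mathbb{F}_q(t)$ that split totally in $\mathbb{F}_q(x)/\mathbb{F}_q(t)$, i.e. over which there lie exactly $\deg(h)$ places of $\mathbb{F}_q(x)$; equivalently, it corresponds to the set of $P\in\mathbb{P}^1(\mathbb{F}_q)$ with $\#\{Q\in\mathbb{P}^1(\mathbb{F}_q):h(Q)=P\}=\deg(h)$.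 *)

theory Defs
  imports
    "HOL-Algebra.Algebraic_Closure_Type"
    "HOL-Algebra.Generated_Fields"
    "HOL-Library.Cardinality"
    "HOL-Library.Disjoint_Sets"
begin

text \<open>
  For a finite field \<^typ>\<open>'a\<close>, the rational function field is the type \<open>'a poly fract\<close>, with
  \<open>x = ratfun_X\<close>. Its subfields and subrings are sets, and the notions of \<open>HOL-Algebra\<close> apply to
  them through \<^const>\<open>ring_of_type_algebra\<close>.
\<close>

definition ratfun_const :: "'a::field \<Rightarrow> 'a poly fract" where
  "ratfun_const c = Fract [:c:] 1"

definition ratfun_X :: "'a::field poly fract" where
  "ratfun_X = Fract [:0, 1:] 1"


subsection \<open>Rational functions as maps on the projective line\<close>

text \<open>Numerator and denominator in lowest terms; making the denominator monic fixes the choice.\<close>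

definition lowest_terms :: "'a::field poly fract \<Rightarrow> 'a poly \<times> 'a poly" where
  "lowest_terms h =
    (THE fg. coprime (fst fg) (snd fg) \<and> lead_coeff (snd fg) = 1 \<and> h = Fract (fst fg) (snd fg))"

lemma lowest_terms_ex1:
  fixes h :: "'a::field poly fract"
  shows "\<exists>!fg. coprime (fst fg) (snd fg) \<and> lead_coeff (snd fg) = 1 \<and> h = Fract (fst fg) (snd fg)"
proof -
  define Q where "Q n \<longleftrightarrow> (\<exists>f g. g \<noteq> 0 \<and> h = Fract f g \<and> Polynomial.degree g = n)" for n
  obtain f0 g0 where "h = Fract f0 g0" "g0 \<noteq> 0"
    by (cases h) auto
  then have "\<exists>n. Q n"
    unfolding Q_def by blast
  then have "Q (LEAST n. Q n)" and least: "\<And>m. Q m \<Longrightarrow> (LEAST n. Q n) \<le> m"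
    by (auto intro: LeastI Least_le)
  then obtain f g where fg: "g \<noteq> 0" "h = Fract f g" "Polynomial.degree g = (LEAST n. Q n)"
    unfolding Q_def by blast
  have cop: "coprime f g"
  proof (rule coprimeI)
    fix c assume "c dvd f" "c dvd g"
    then obtain u v where uv: "f = c * u" "g = c * v"
      by (auto elim!: dvdE)
    then have nz: "c \<noteq> 0" "v \<noteq> 0"
      using fg by auto
    have "h = Fract u v"
      using fg uv nz by (simp add: eq_fract)
    then have "Q (Polynomial.degree v)"
      unfolding Q_def using nz by blast
    then have "Polynomial.degree g \<le> Polynomial.degree v"
      using least fg by simp
    then have "Polynomial.degree c = 0"
      using uv nz by (simp add: degree_mult_eq)
    then show "is_unit c"
      using nz by (simp add: is_unit_iff_degree)
  qed
  let ?a = "inverse (lead_coeff g)"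
  have a: "?a \<noteq> 0" "lead_coeff g \<noteq> 0"
    using fg(1) by simp_all
  have ex: "coprime (smult ?a f) (smult ?a g) \<and> lead_coeff (smult ?a g) = 1 \<and>
      h = Fract (smult ?a f) (smult ?a g)"
  proof (intro conjI)
    show "coprime (smult ?a f) (smult ?a g)"
    proof (rule coprimeI)
      fix c assume "c dvd smult ?a f" "c dvd smult ?a g"
      then have "c dvd f" "c dvd g"
        using a by (auto simp: dvd_smult_iff)
      then show "is_unit c"
        using cop coprime_common_divisor by blast
    qed
    show "lead_coeff (smult ?a g) = 1"
      using a by simp
    show "h = Fract (smult ?a f) (smult ?a g)"
      using fg a by (simp add: eq_fract)
  qed
  have uniq: "fg' = (smult ?a f, smult ?a g)"
    if fg': "coprime (fst fg') (snd fg') \<and> lead_coeff (snd fg') = 1 \<and> h = Fract (fst fg') (snd fg')"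
    for fg' :: "'a poly \<times> 'a poly"
  proof -
    obtain f' g' where eq: "fg' = (f', g')"
      by (cases fg')
    have c: "coprime f' g'" and l: "lead_coeff g' = 1" and F: "h = Fract f' g'"
      using fg' eq by auto
    have nz: "g' \<noteq> 0"
      using l by auto
    have cross: "f' * g = f * g'"
      using F fg nz by (simp add: eq_fract)
    define s where "s = g' div g"
    define r where "r = g' - s * g"
    have r_mod: "r = g' mod g"
      unfolding r_def s_def by (simp add: minus_div_mult_eq_mod)
    have "r = 0"
    proof (rule ccontr)
      assume "r \<noteq> 0"
      have "h = Fract (f' - s * f) r"
        using fg(1) \<open>r \<noteq> 0\<close> cross unfolding fg(2) r_def by (simp add: eq_fract algebra_simps)
      then have "Q (Polynomial.degree r)"
        unfolding Q_def using \<open>r \<noteq> 0\<close> by blast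
      then have "Polynomial.degree g \<le> Polynomial.degree r"
        using least fg by simp
      moreover have "Polynomial.degree r < Polynomial.degree g"
        using degree_mod_less[of g g'] \<open>r \<noteq> 0\<close> fg(1) r_mod by auto
      ultimately show False
        by simp
    qed
    then have g': "g' = s * g"
      unfolding r_def by simp
    then have "f' * g = (s * f) * g"
      using cross by (simp add: algebra_simps)
    then have f': "f' = s * f"
      using fg(1) by simp
    have "is_unit s"
      by (rule coprime_common_divisor[OF c]) (simp_all add: f' g')
    then obtain b where b: "s = [:b:]"
      by (auto simp: is_unit_poly_iff)
    have "b * lead_coeff g = 1"
      using l unfolding g' b by (simp split: if_splits)
    then have "b = ?a"
      using a by (simp add: field_simps)
    then show ?thesis
      using eq f' g' b by simp
  qed
  show ?thesis
    by (rule ex1I[of _ "(smult ?a f, smult ?a g)"]) (use ex uniq in auto)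
qed

definition ratfun_degree :: "'a::field poly fract \<Rightarrow> nat" where
  "ratfun_degree h =
    (case lowest_terms h of (f, g) \<Rightarrow> max (Polynomial.degree f) (Polynomial.degree g))"

datatype 'a proj_line = Affine 'a | Infinity

text \<open>
  At \<^const>\<open>Infinity\<close> the value of \<open>f / g\<close> is the quotient of the coefficients of \<open>x\<^sup>n\<close>, where
  \<open>n = max (deg f) (deg g)\<close>; it is infinite iff \<open>g\<close> has degree less than \<open>n\<close>.
\<close>

definition ratfun_eval :: "'a::field poly fract \<Rightarrow> 'a proj_line \<Rightarrow> 'a proj_line" where
  "ratfun_eval h P =
    (case lowest_terms h of (f, g) \<Rightarrow>
      (case P of
        Affine a \<Rightarrow> if poly g a = 0 then Infinity else Affine (poly f a / poly g a)
      | Infinity \<Rightarrow>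
          if Polynomial.degree g < Polynomial.degree f then Infinity
          else Affine (Polynomial.coeff f (Polynomial.degree g) / lead_coeff g)))"

definition good :: "nat \<Rightarrow> nat \<Rightarrow> 'a::field poly fract \<Rightarrow> bool" where
  "good r l h \<longleftrightarrow>
    l \<ge> 1 \<and> ratfun_degree h = r + 1 \<and>
    (\<exists>A :: nat \<Rightarrow> 'a proj_line set.
      disjoint_family_on A {1..l} \<and>
      (\<forall>i\<in>{1..l}. card (A i) = r + 1 \<and> (\<exists>t. ratfun_eval h ` A i = {t})))"


subsection \<open>Galois extensions\<close>

text \<open>
  \<open>K\<close> is a subfield of the field \<^typ>\<open>'b\<close>. The extension \<open>'b/K\<close> is Galois if it is finite and
  \<open>|Aut('b/K)| = ['b : K]\<close>.
\<close>

definition automorphisms_over :: "'b::field set \<Rightarrow> ('b \<Rightarrow> 'b) set" where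
  "automorphisms_over K =
    {\<sigma> \<in> ring_iso ring_of_type_algebra ring_of_type_algebra. \<forall>a\<in>K. \<sigma> a = a}"

definition galois_over :: "'b::field set \<Rightarrow> bool" where
  "galois_over K \<longleftrightarrow>
    subfield K ring_of_type_algebra \<and>
    ring.finite_dimension ring_of_type_algebra K UNIV \<and>
    card (automorphisms_over K) = ring.dim ring_of_type_algebra K UNIV"


subsection \<open>Places\<close>

text \<open>
  Here \<open>k \<subseteq> F\<close> are subfields of an ambient field \<^typ>\<open>'b\<close>: a function field \<open>F\<close> with field of
  constants \<open>k\<close>.
\<close>

definition valuation_ring :: "'b::field set \<Rightarrow> 'b set \<Rightarrow> 'b set \<Rightarrow> bool" where
  "valuation_ring k F V \<longleftrightarrow>
    subring V ring_of_type_algebra \<and> k \<subset> V \<and> V \<subset> F \<and> (\<forall>z\<in>F. z \<in> V \<or> inverse z \<in> V)"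

definition place_of :: "'b::field set \<Rightarrow> 'b set \<Rightarrow> 'b set \<Rightarrow> 'b set \<Rightarrow> bool" where
  "place_of k F V P \<longleftrightarrow>
    valuation_ring k F V \<and> maximalideal P (ring_of_type_algebra\<lparr>carrier := V\<rparr>)"

definition places :: "'b::field set \<Rightarrow> 'b set \<Rightarrow> 'b set set" where
  "places k F = {P. \<exists>V. place_of k F V P}"

text \<open>A place is rational (of degree one) if \<open>k\<close> maps onto its residue class field \<open>V / P\<close>.\<close>

definition rational_places :: "'b::field set \<Rightarrow> 'b set \<Rightarrow> 'b set set" where
  "rational_places k F = {P. \<exists>V. place_of k F V P \<and> (\<forall>z\<in>V. \<exists>c\<in>k. z - c \<in> P)}"

text \<open>For an extension field \<open>E\<close> of \<open>F\<close>; a place \<open>Q\<close> of \<open>E\<close> lies over \<open>P\<close> iff \<open>P \<subseteq> Q\<close>.\<close>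

definition places_over :: "'b::field set \<Rightarrow> 'b set \<Rightarrow> 'b set \<Rightarrow> 'b set set" where
  "places_over k E P = {Q \<in> places k E. P \<subseteq> Q}"


subsection \<open>The subfield generated by a rational function\<close>

definition ratfun_subfield :: "'a::field poly fract \<Rightarrow> 'a poly fract set" where
  "ratfun_subfield h = generate_field ring_of_type_algebra (range ratfun_const \<union> {h})"

definition T1_split :: "'a::field poly fract \<Rightarrow> 'a poly fract set set" where
  "T1_split h =
    {P \<in> rational_places (range ratfun_const) (ratfun_subfield h).
      card (places_over (range ratfun_const) UNIV P) = ratfun_degree h}"

end

theory Submission
  imports Defs "HOL-Computational_Algebra.Polynomial_Factorial" "HOL-Number_Theory.Residues"
begin

text \<open>
  The map \<open>h\<close> is invariant under the homography \<open>g(x) = - d\<^sup>2 / (2 (x - d))\<close>, which has order 4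
  and permutes the poles \<open>\<infinity>, 0, d/2, d\<close> cyclically. Since \<open>h\<close> has degree 4, its fibres are the orbits of
  \<open>g\<close>, and \<open>F(x)/F(h)\<close> is Galois with cyclic group of order 4. All nontrivial powers of \<open>g\<close> have the same
  fixed points, the roots of \<open>2 x\<^sup>2 - 2 d x + d\<^sup>2\<close>, so every orbit outside them has 4 elements. There
  are 0 or 2 rational fixed points, and as 4 divides \<open>q + 1\<close> minus their number, \<open>q mod 4\<close>
  decides which case occurs.
\<close>

text \<open>The group explains the formula: h is the sum of x over the orbit of g, because the orbit
  is the set of roots of 4 Y^4 - 4 h Y^3 + ..., which is \<open>numer\<close> - h
  \<open>denom\<close> in the variable Y. The obstacle is \<open>T1_split\<close>: it counts all
  places of F(x) above P, of any degree, and a place is a maximal ideal of an abstract valuation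
  ring. No full classification of places is made. A rational place of F(h) is identified with the
  value that h takes there, and a place of F(x) lies above it iff h takes the same value. At a
  finite value c, all these places contain the value at x of the quartic \<open>numer\<close> - c
  \<open>denom\<close>; hence there are at most 4, and if there are 4, each belongs to a rational
  point. In this way split places become fibres with 4 points. The degree [F(x) : F(h)] = 4 comes
  from an explicit basis 1, x, x^2, x^3: the four conjugates of x give independence, the quartic
  equation of x gives generation.\<close>

section \<open>Rings and subfields inside a field type\<close>

lemma field_type_algebra: "field (ring_of_type_algebra :: 'b::field ring)"
  by (rule field_from_type_algebra)

lemma ring_type_algebra: "ring (ring_of_type_algebra :: 'b::field ring)"
  by (rule ring_from_type_algebra)

lemma type_algebra_simps [simp]:
  "carrier ring_of_type_algebra = (UNIV :: 'b::field set)"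
  "\<one>\<^bsub>ring_of_type_algebra\<^esub> = (1 :: 'b)"
  "\<zero>\<^bsub>ring_of_type_algebra\<^esub> = (0 :: 'b)"
  "a \<otimes>\<^bsub>ring_of_type_algebra\<^esub> b = (a * b :: 'b)"
  "a \<oplus>\<^bsub>ring_of_type_algebra\<^esub> b = (a + b :: 'b)"
  by (simp_all add: ring_of_type_algebra_def)

lemma type_algebra_a_inv [simp]: "\<ominus>\<^bsub>ring_of_type_algebra\<^esub> a = - (a :: 'b::field)"
proof -
  interpret ring "ring_of_type_algebra :: 'b ring" by (rule ring_type_algebra)
  have "(- a) \<oplus>\<^bsub>ring_of_type_algebra\<^esub> a = \<zero>\<^bsub>ring_of_type_algebra\<^esub>" by simp
  from minus_equality[OF this] show ?thesis by simp
qed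

lemma type_algebra_m_inv [simp]:
  assumes "(a :: 'b::field) \<noteq> 0"
  shows "inv\<^bsub>ring_of_type_algebra\<^esub> a = inverse a"
proof -
  interpret field "ring_of_type_algebra :: 'b ring" by (rule field_type_algebra)
  show ?thesis
    using assms by (intro comm_inv_char) auto
qed

lemma subring_type_algebra_iff:
  "subring V (ring_of_type_algebra :: 'b::field ring) \<longleftrightarrow>
    1 \<in> V \<and> (\<forall>a\<in>V. - a \<in> V) \<and> (\<forall>a\<in>V. \<forall>b\<in>V. a * b \<in> V) \<and> (\<forall>a\<in>V. \<forall>b\<in>V. a + b \<in> V)"
proof
  assume "subring V (ring_of_type_algebra :: 'b ring)"
  from subringE[OF this] show "1 \<in> V \<and> (\<forall>a\<in>V. - a \<in> V) \<and> (\<forall>a\<in>V. \<forall>b\<in>V. a * b \<in> V) \<and> (\<forall>a\<in>V. \<forall>b\<in>V. a + b \<in> V)"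
    by simp
next
  interpret ring "ring_of_type_algebra :: 'b ring" by (rule ring_type_algebra)
  show "subring V (ring_of_type_algebra :: 'b ring)"
    if "1 \<in> V \<and> (\<forall>a\<in>V. - a \<in> V) \<and> (\<forall>a\<in>V. \<forall>b\<in>V. a * b \<in> V) \<and> (\<forall>a\<in>V. \<forall>b\<in>V. a + b \<in> V)"
    using that by (intro subringI) auto
qed

lemma subfield_type_algebra_iff:
  "subfield F (ring_of_type_algebra :: 'b::field ring) \<longleftrightarrow>
    subring F (ring_of_type_algebra :: 'b ring) \<and> (\<forall>a\<in>F. inverse a \<in> F)"
proof -
  interpret field "ring_of_type_algebra :: 'b ring" by (rule field_type_algebra)
  show ?thesis
  proof (intro iffI conjI ballI)
    assume F: "subfield F (ring_of_type_algebra :: 'b ring)"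
    show "subring F (ring_of_type_algebra :: 'b ring)"
      using F by (rule subfieldE)
    fix a assume "a \<in> F"
    then show "inverse a \<in> F"
      using subfield_m_inv(1)[OF F, of a] by (cases "a = 0") auto
  next
    assume "subring F (ring_of_type_algebra :: 'b ring) \<and> (\<forall>a\<in>F. inverse a \<in> F)"
    then show "subfield F (ring_of_type_algebra :: 'b ring)"
      by (intro subfieldI') auto
  qed
qed

subsection \<open>Valuation rings\<close>

text \<open>The case z = 0 is listed separately because \<open>inverse 0 = 0\<close> lies in
  V.\<close>

definition nonunits :: "'b::field set \<Rightarrow> 'b set" where
  "nonunits V = {z \<in> V. z = 0 \<or> inverse z \<notin> V}"

locale valued_field =
  fixes k F V :: "'b::field set"
  assumes F: "subfield F ring_of_type_algebra"
    and val: "valuation_ring k F V"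
begin

lemma subring_V: "subring V ring_of_type_algebra" and k_sub: "k \<subset> V" and V_sub: "V \<subset> F"
  and V_or: "z \<in> F \<Longrightarrow> z \<in> V \<or> inverse z \<in> V"
  using val unfolding valuation_ring_def by auto

lemma V_closed [simp]:
  "1 \<in> V" "0 \<in> V" "a \<in> V \<Longrightarrow> - a \<in> V"
  "a \<in> V \<Longrightarrow> b \<in> V \<Longrightarrow> a * b \<in> V" "a \<in> V \<Longrightarrow> b \<in> V \<Longrightarrow> a + b \<in> V"
  "a \<in> V \<Longrightarrow> b \<in> V \<Longrightarrow> a - b \<in> V"
  using subringE[OF subring_V] by (auto simp: diff_conv_add_uminus simp del: add_uminus_conv_diff)

lemma F_closed:
  "1 \<in> F" "0 \<in> F" "a \<in> F \<Longrightarrow> - a \<in> F"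
  "a \<in> F \<Longrightarrow> b \<in> F \<Longrightarrow> a * b \<in> F" "a \<in> F \<Longrightarrow> b \<in> F \<Longrightarrow> a + b \<in> F"
  "a \<in> F \<Longrightarrow> inverse a \<in> F"
  using F subringE[OF subfieldE(1)[OF F]] by (auto simp: subfield_type_algebra_iff)

abbreviation M where "M \<equiv> nonunits V"

lemma M_sub: "z \<in> M \<Longrightarrow> z \<in> V"
  by (simp add: nonunits_def)

lemma zero_in_M [simp]: "0 \<in> M" and one_notin_M [simp]: "1 \<notin> M"
  by (simp_all add: nonunits_def)

text \<open>If a z were a unit of V, then a times its inverse would be an inverse of z in V.\<close>

lemma M_mult: "a \<in> V \<Longrightarrow> z \<in> M \<Longrightarrow> a * z \<in> M"
proof -
  assume a: "a \<in> V" and z: "z \<in> M"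
  show "a * z \<in> M"
  proof (rule ccontr)
    assume "a * z \<notin> M"
    then have *: "a * z \<noteq> 0" "inverse (a * z) \<in> V"
      using a z by (auto simp: nonunits_def)
    then have "a * inverse (a * z) \<in> V" using a by (intro V_closed)
    moreover have "a * inverse (a * z) = inverse z" using * by simp
    ultimately have "inverse z \<in> V" by metis
    then show False using z * by (simp add: nonunits_def)
  qed
qed

lemma M_mult': "a \<in> V \<Longrightarrow> z \<in> M \<Longrightarrow> z * a \<in> M"
  using M_mult[of a z] by (simp add: mult.commute)

lemma M_uminus: "z \<in> M \<Longrightarrow> - z \<in> M"
  using M_mult[of "-1" z] by simp

text \<open>This is where the valuation property enters: one of z/w and w/z lies in V, and z + w =
  (z/w + 1) w, or the same with the roles exchanged.\<close>

lemma M_add: 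
  assumes z: "z \<in> M" and w: "w \<in> M"
  shows "z + w \<in> M"
proof (cases "z = 0 \<or> w = 0")
  case True
  then show ?thesis using z w by auto
next
  case False
  have *: "a + b \<in> M" if "a \<in> M" "b \<in> M" "b \<noteq> 0" "a / b \<in> V" for a b
  proof -
    have "(a / b + 1) * b \<in> M" using that by (intro M_mult) auto
    moreover have "(a / b + 1) * b = a + b" using that by (simp add: distrib_right)
    ultimately show ?thesis by simp
  qed
  have "z / w \<in> F"
    unfolding divide_inverse using subsetD[OF psubset_imp_subset[OF V_sub]] M_sub z w
    by (intro F_closed(4,6)) auto
  then have "z / w \<in> V \<or> w / z \<in> V"
    using V_or[of "z / w"] by simp
  then show ?thesis
    using *[of z w] *[of w z] z w False by (auto simp: add.commute)
qed

lemma M_diff: "z \<in> M \<Longrightarrow> w \<in> M \<Longrightarrow> z - w \<in> M"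
  using M_add[of z "- w"] M_uminus[of w] by simp

lemma M_prime: "a \<in> V \<Longrightarrow> b \<in> V \<Longrightarrow> a * b \<in> M \<Longrightarrow> a \<in> M \<or> b \<in> M"
  by (auto simp: nonunits_def)

lemma inverse_in_M: "z \<in> F \<Longrightarrow> z \<notin> V \<Longrightarrow> inverse z \<in> M"
  using V_or[of z] by (auto simp: nonunits_def)

lemma unit_V: "z \<in> V \<Longrightarrow> z \<notin> M \<Longrightarrow> inverse z \<in> V \<and> z \<noteq> 0 \<and> inverse z \<notin> M"
  by (auto simp: nonunits_def)

lemma ring_V: "ring (ring_of_type_algebra\<lparr>carrier := V\<rparr>)"
  by (intro ring.subring_is_ring ring_type_algebra subring_V)

lemma ideal_M: "ideal M (ring_of_type_algebra\<lparr>carrier := V\<rparr>)"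
proof (rule idealI)
  show "ring (ring_of_type_algebra\<lparr>carrier := V\<rparr>)" by (rule ring_V)
  interpret VR: ring "ring_of_type_algebra\<lparr>carrier := V\<rparr>" by (rule ring_V)
  have m: "\<ominus>\<^bsub>ring_of_type_algebra\<lparr>carrier := V\<rparr>\<^esub> a \<in> M" if "a \<in> M" for a
  proof -
    have "- a = \<ominus>\<^bsub>ring_of_type_algebra\<lparr>carrier := V\<rparr>\<^esub> a"
      using that M_sub[OF that] by (intro VR.minus_equality[symmetric]) auto
    then show ?thesis using M_uminus[OF that] by simp
  qed
  show "subgroup M (add_monoid (ring_of_type_algebra\<lparr>carrier := V\<rparr>))"
    by (rule VR.add.subgroupI) (use m M_add M_sub in \<open>auto intro: zero_in_M simp: a_inv_def simp del: type_algebra_a_inv\<close>)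
qed (auto simp: M_mult M_mult')

lemma proper_ideal_sub_M:
  assumes "ideal J (ring_of_type_algebra\<lparr>carrier := V\<rparr>)" and "J \<noteq> V"
  shows "J \<subseteq> M"
proof
  interpret ideal J "ring_of_type_algebra\<lparr>carrier := V\<rparr>" by fact
  fix z assume z: "z \<in> J"
  then have zV: "z \<in> V" using a_subset by auto
  show "z \<in> M"
  proof (rule ccontr)
    assume "z \<notin> M"
    with zV have i: "inverse z \<in> V" "z \<noteq> 0" using unit_V by auto
    have "a \<in> J" if "a \<in> V" for a
      using I_l_closed[of z "a * inverse z"] z i that by (simp add: mult.assoc)
    then show False using assms a_subset by auto
  qed
qed

text \<open>A valuation ring is local: a proper ideal contains no unit, hence lies in M. A place is
  thus the set of nonunits of its valuation ring, and no further choice of an ideal remains.\<close>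

lemma maximalideal_iff: "maximalideal P (ring_of_type_algebra\<lparr>carrier := V\<rparr>) \<longleftrightarrow> P = M"
proof
  assume "maximalideal P (ring_of_type_algebra\<lparr>carrier := V\<rparr>)"
  then interpret maximalideal P "ring_of_type_algebra\<lparr>carrier := V\<rparr>" .
  have "P \<subseteq> M"
    using I_notcarr is_ideal by (intro proper_ideal_sub_M) auto
  moreover have "M \<noteq> V" using V_closed(1) one_notin_M by metis
  moreover have "M \<subseteq> V" using M_sub by auto
  ultimately show "P = M"
    using I_maximal[OF ideal_M] by auto
next
  assume P: "P = M"
  have "M \<noteq> V" using V_closed(1) one_notin_M by metis
  then show "maximalideal P (ring_of_type_algebra\<lparr>carrier := V\<rparr>)"
    unfolding P by (intro maximalidealI ideal_M) (use proper_ideal_sub_M in auto)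
qed

end

lemma place_of_iff:
  assumes "subfield F (ring_of_type_algebra :: 'b::field ring)"
  shows "place_of k F V P \<longleftrightarrow> valuation_ring k F V \<and> P = nonunits V"
  using assms valued_field.maximalideal_iff[of k F V]
  by (auto simp: place_of_def valued_field_def)

subsection \<open>Substitution in rational functions\<close>

lemma ratfun_const_hom [simp]:
  "ratfun_const 0 = 0" "ratfun_const 1 = 1"
  "ratfun_const (a + b) = ratfun_const a + ratfun_const b"
  "ratfun_const (a * b) = ratfun_const a * ratfun_const b"
  "ratfun_const (- a) = - ratfun_const a"
  "ratfun_const (a - b) = ratfun_const a - ratfun_const b"
  by (simp_all add: ratfun_const_def Zero_fract_def One_fract_def one_pCons eq_fract algebra_simps)

lemma ratfun_const_eq_iff [simp]: "ratfun_const a = ratfun_const b \<longleftrightarrow> a = b"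
  by (simp add: ratfun_const_def eq_fract)

lemma ratfun_const_eq_0_iff [simp]: "ratfun_const a = 0 \<longleftrightarrow> a = 0"
  using ratfun_const_eq_iff[of a 0] by (simp del: ratfun_const_eq_iff)

lemma ratfun_const_numeral [simp]: "ratfun_const (numeral n) = numeral n"
proof -
  have "ratfun_const (of_nat m) = of_nat m" for m
    by (induction m) simp_all
  from this[of "numeral n"] show ?thesis by simp
qed

lemma ratfun_const_power [simp]: "ratfun_const (a ^ n) = ratfun_const a ^ n"
  by (induction n) simp_all

lemma ratfun_const_inverse [simp]: "ratfun_const (inverse a) = inverse (ratfun_const a)"
proof (cases "a = 0")
  case False
  then have "ratfun_const a * ratfun_const (inverse a) = 1"
    by (simp flip: ratfun_const_hom(4))
  then show ?thesis by (rule inverse_unique[symmetric])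
qed simp

lemma ratfun_const_divide [simp]: "ratfun_const (a / b) = ratfun_const a / ratfun_const b"
  by (simp add: divide_inverse)

text \<open>Every rational function is a quotient of two such values at s = x. Keeping s general
  lets the same lemmas serve x, h and their inverses.\<close>

definition ratfun_subst :: "'a::field poly \<Rightarrow> 'a poly fract \<Rightarrow> 'a poly fract" where
  "ratfun_subst u s = poly (map_poly ratfun_const u) s"

lemma ratfun_subst_0 [simp]: "ratfun_subst 0 s = 0"
  by (simp add: ratfun_subst_def)

lemma ratfun_subst_pCons [simp]: "ratfun_subst (pCons c u) s = ratfun_const c + s * ratfun_subst u s"
  by (simp add: ratfun_subst_def map_poly_pCons)

lemma ratfun_subst_1 [simp]: "ratfun_subst 1 s = 1"
  by (simp add: one_pCons)

lemma ratfun_subst_add [simp]: "ratfun_subst (u + v) s = ratfun_subst u s + ratfun_subst v s"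
  by (induction u v rule: poly_induct2) (simp_all add: algebra_simps)

lemma ratfun_subst_smult [simp]: "ratfun_subst (smult c u) s = ratfun_const c * ratfun_subst u s"
  by (induction u) (simp_all add: algebra_simps)

lemma ratfun_subst_mult [simp]: "ratfun_subst (u * v) s = ratfun_subst u s * ratfun_subst v s"
  by (induction u) (simp_all add: algebra_simps)

lemma ratfun_subst_minus [simp]: "ratfun_subst (- u) s = - ratfun_subst u s"
  using ratfun_subst_smult[of "-1" u s] by simp

lemma ratfun_subst_diff [simp]: "ratfun_subst (u - v) s = ratfun_subst u s - ratfun_subst v s"
  using ratfun_subst_add[of u "- v" s] by simp

lemma ratfun_subst_X: "ratfun_subst u ratfun_X = Fract u 1"
proof (induction u)
  case 0
  show ?case by (simp add: Zero_fract_def)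
next
  case (pCons a u)
  have "pCons a u = [:a:] + [:0, 1:] * u" by simp
  then show ?case
    unfolding ratfun_subst_pCons pCons.IH by (simp add: ratfun_const_def ratfun_X_def)
qed

lemma Fract_ratfun_subst: "Fract u v = ratfun_subst u ratfun_X / ratfun_subst v ratfun_X"
  by (simp add: ratfun_subst_X)

text \<open>Division of u by X - c leaves the remainder u(c). At a place containing s - c this makes
  u(s) congruent to the constant u(c).\<close>

lemma ratfun_subst_remainder:
  obtains w where "ratfun_subst u s = (s - ratfun_const c) * ratfun_subst w s + ratfun_const (poly u c)"
proof -
  have "u = [:-c, 1:] * synthetic_div u c + [:poly u c:]"
    using synthetic_div_correct'[of c u] by simp
  then have "ratfun_subst u s = ratfun_subst ([:-c, 1:] * synthetic_div u c + [:poly u c:]) s"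
    by simp
  then show ?thesis
    by (intro that[of "synthetic_div u c"]) (simp del: mult_pCons_left)
qed

section \<open>The subfield F(s) as a set of quotients\<close>

lemma subfield_ratfun_subfield: "subfield (ratfun_subfield s) ring_of_type_algebra"
proof -
  interpret field "ring_of_type_algebra :: 'a poly fract ring" by (rule field_type_algebra)
  show ?thesis
    unfolding ratfun_subfield_def by (rule generate_field_is_subfield) simp
qed

lemma ratfun_subfield_closed:
  "1 \<in> ratfun_subfield s" "0 \<in> ratfun_subfield s"
  "a \<in> ratfun_subfield s \<Longrightarrow> - a \<in> ratfun_subfield s"
  "a \<in> ratfun_subfield s \<Longrightarrow> b \<in> ratfun_subfield s \<Longrightarrow> a * b \<in> ratfun_subfield s"
  "a \<in> ratfun_subfield s \<Longrightarrow> b \<in> ratfun_subfield s \<Longrightarrow> a + b \<in> ratfun_subfield s"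
  "a \<in> ratfun_subfield s \<Longrightarrow> b \<in> ratfun_subfield s \<Longrightarrow> a - b \<in> ratfun_subfield s"
  "a \<in> ratfun_subfield s \<Longrightarrow> inverse a \<in> ratfun_subfield s"
  "a \<in> ratfun_subfield s \<Longrightarrow> b \<in> ratfun_subfield s \<Longrightarrow> a / b \<in> ratfun_subfield s"
  using subfield_ratfun_subfield[of s] subringE[OF subfieldE(1)[OF subfield_ratfun_subfield[of s]]]
  by (auto simp: subfield_type_algebra_iff divide_inverse diff_conv_add_uminus simp del: add_uminus_conv_diff)

lemma ratfun_const_in_subfield [simp]: "ratfun_const c \<in> ratfun_subfield s"
  and generator_in_subfield [simp]: "s \<in> ratfun_subfield s"
  by (auto simp: ratfun_subfield_def intro: generate_field.incl)

lemma ratfun_subst_in_subfield: "t \<in> ratfun_subfield s \<Longrightarrow> ratfun_subst u t \<in> ratfun_subfield s"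
  by (induction u) (auto intro!: ratfun_subfield_closed)

lemma ratfun_subfield_cases:
  assumes "z \<in> ratfun_subfield s"
  obtains u v where "ratfun_subst v s \<noteq> 0" "z = ratfun_subst u s / ratfun_subst v s"
proof -
  have "\<exists>u v. ratfun_subst v s \<noteq> 0 \<and> z = ratfun_subst u s / ratfun_subst v s"
    using assms unfolding ratfun_subfield_def
  proof (induction rule: generate_field.induct)
    case one
    show ?case by (intro exI[of _ 1]) auto
  next
    case (incl z)
    show ?case
    proof (cases "z = s")
      case True
      then show ?thesis by (intro exI[of _ "[:0, 1:]"] exI[of _ 1]) auto
    next
      case False
      with incl obtain c where "z = ratfun_const c" by auto
      then show ?thesis by (intro exI[of _ "[:c:]"] exI[of _ 1]) auto
    qed
  next
    case (a_inv z)
    then obtain u v where "ratfun_subst v s \<noteq> 0" "z = ratfun_subst u s / ratfun_subst v s" by blast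
    then show ?case by (intro exI[of _ "- u"] exI[of _ v]) auto
  next
    case (m_inv z)
    then obtain u v where *: "ratfun_subst v s \<noteq> 0" "z = ratfun_subst u s / ratfun_subst v s" by blast
    with m_inv show ?case by (intro exI[of _ v] exI[of _ u]) auto
  next
    case (eng_add z1 z2)
    then obtain u v u' v' where "ratfun_subst v s \<noteq> 0" "z1 = ratfun_subst u s / ratfun_subst v s"
       "ratfun_subst v' s \<noteq> 0" "z2 = ratfun_subst u' s / ratfun_subst v' s" by blast
    then show ?case by (intro exI[of _ "u * v' + u' * v"] exI[of _ "v * v'"]) (auto simp: add_frac_eq)
  next
    case (eng_mult z1 z2)
    then obtain u v u' v' where "ratfun_subst v s \<noteq> 0" "z1 = ratfun_subst u s / ratfun_subst v s"
       "ratfun_subst v' s \<noteq> 0" "z2 = ratfun_subst u' s / ratfun_subst v' s" by blast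
    then show ?case by (intro exI[of _ "u * u'"] exI[of _ "v * v'"]) auto
  qed
  then show ?thesis using that by blast
qed

lemma ratfun_subfield_mono:
  assumes "t \<in> ratfun_subfield s"
  shows "ratfun_subfield t \<subseteq> ratfun_subfield s"
  by (auto elim!: ratfun_subfield_cases intro!: ratfun_subfield_closed ratfun_subst_in_subfield assms)

lemma ratfun_subfield_inverse: "ratfun_subfield (inverse s) = ratfun_subfield s"
  using ratfun_subfield_mono[of s "inverse s"] ratfun_subfield_mono[of "inverse s" s]
    ratfun_subfield_closed(7)[of s s] ratfun_subfield_closed(7)[of "inverse s" "inverse s"]
  by auto

lemma ratfun_subfield_X: "ratfun_subfield ratfun_X = UNIV"
proof -
  have "z \<in> ratfun_subfield ratfun_X" for z :: "'a poly fract"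
    by (cases z) (auto simp: Fract_ratfun_subst intro!: ratfun_subfield_closed ratfun_subst_in_subfield)
  then show ?thesis by auto
qed

text \<open>A denominator of least degree does it: cancelling a common nonunit factor p would lower
  the degree. The application takes for p the polynomial that describes a given place.\<close>

lemma ratfun_subfield_reduced:
  assumes "z \<in> ratfun_subfield s" and "\<not> is_unit p"
  obtains u v where "ratfun_subst v s \<noteq> 0" "z = ratfun_subst u s / ratfun_subst v s"
    "\<not> p dvd u \<or> \<not> p dvd v"
proof -
  define Q where "Q v \<longleftrightarrow> (\<exists>u. ratfun_subst v s \<noteq> 0 \<and> z = ratfun_subst u s / ratfun_subst v s)" for v
  have ex: "\<exists>v. Q v" using assms by (elim ratfun_subfield_cases) (auto simp: Q_def)
  define v where "v = (ARG_MIN Polynomial.degree v. Q v)"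
  have Qv: "Q v" and min: "\<And>w. Q w \<Longrightarrow> Polynomial.degree v \<le> Polynomial.degree w"
    using ex arg_min_natI[of Q _ Polynomial.degree] arg_min_nat_le[of Q _ Polynomial.degree]
    unfolding v_def by blast+
  then obtain u where u: "ratfun_subst v s \<noteq> 0" "z = ratfun_subst u s / ratfun_subst v s"
    by (auto simp: Q_def)
  have "\<not> p dvd u \<or> \<not> p dvd v"
  proof (rule ccontr)
    assume "\<not> ?thesis"
    then obtain u' v' where uv: "u = p * u'" "v = p * v'" by (auto elim!: dvdE)
    have nz: "p \<noteq> 0" "v' \<noteq> 0" using u uv by auto
    then have deg: "Polynomial.degree p \<noteq> 0" using assms(2) is_unit_iff_degree by blast
    have "Q v'" unfolding Q_def using u uv by (intro exI[of _ u']) auto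
    from min[OF this] show False using deg nz uv by (simp add: degree_mult_eq)
  qed
  then show ?thesis using that u by blast
qed

subsection \<open>Places of a simple extension of the constants\<close>

text \<open>The places where s is finite. At any other place \<open>inverse s\<close> lies in V, and
  it generates the same subfield, so those are covered by exchanging s for
  \<open>inverse s\<close>.\<close>

locale ratfun_place = valued_field "range ratfun_const" "ratfun_subfield s" V
  for s :: "'a::field poly fract" and V +
  assumes s_in_V: "s \<in> V"
begin

lemma const_in_V [simp]: "ratfun_const c \<in> V"
  using k_sub by auto

lemma const_in_M_iff [simp]: "ratfun_const c \<in> M \<longleftrightarrow> c = 0"
  using const_in_V[of "inverse c"] by (auto simp: nonunits_def)

lemma subst_in_V [simp]: "ratfun_subst u s \<in> V"
  by (induction u) (auto simp: s_in_V)

lemma subst_in_M_iff: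
  assumes "s - ratfun_const c \<in> M"
  shows "ratfun_subst u s \<in> M \<longleftrightarrow> poly u c = 0"
proof -
  obtain w where w: "ratfun_subst u s = (s - ratfun_const c) * ratfun_subst w s + ratfun_const (poly u c)"
    by (rule ratfun_subst_remainder)
  have "(s - ratfun_const c) * ratfun_subst w s \<in> M" (is "?m \<in> M") using assms by (intro M_mult') auto
  then have "ratfun_subst u s \<in> M \<longleftrightarrow> ratfun_const (poly u c) \<in> M"
    using M_add[of ?m "ratfun_const (poly u c)"] M_diff[of "ratfun_subst u s" ?m] w by auto
  then show ?thesis by simp
qed

text \<open>The polynomials u with u(s) in M form an ideal of F[X], generated by a nonzero element
  of least degree by division with remainder. If only u = 0 qualifies, the generator is 0.\<close>

lemma vanishing_ideal_generator: "\<exists>p. \<forall>u. ratfun_subst u s \<in> M \<longleftrightarrow> p dvd u"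
proof (cases "\<exists>p. p \<noteq> 0 \<and> ratfun_subst p s \<in> M")
  case False
  then show ?thesis by (metis dvd_0_left_iff ratfun_subst_0 zero_in_M)
next
  case True
  define p where "p = (ARG_MIN Polynomial.degree p. p \<noteq> 0 \<and> ratfun_subst p s \<in> M)"
  have p: "p \<noteq> 0 \<and> ratfun_subst p s \<in> M"
    and min: "\<And>u. u \<noteq> 0 \<and> ratfun_subst u s \<in> M \<Longrightarrow> Polynomial.degree p \<le> Polynomial.degree u"
    using True arg_min_natI[of "\<lambda>p. p \<noteq> 0 \<and> ratfun_subst p s \<in> M" _ Polynomial.degree]
      arg_min_nat_le[of "\<lambda>p. p \<noteq> 0 \<and> ratfun_subst p s \<in> M" _ Polynomial.degree] unfolding p_def by blast+
  have "ratfun_subst u s \<in> M \<longleftrightarrow> p dvd u" for u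
  proof
    assume u: "ratfun_subst u s \<in> M"
    have "u mod p = u - p * (u div p)" by (simp add: minus_mult_div_eq_mod)
    then have "ratfun_subst (u mod p) s = ratfun_subst u s - ratfun_subst p s * ratfun_subst (u div p) s"
      by simp
    then have "ratfun_subst (u mod p) s \<in> M"
      using u p by (auto intro!: M_diff M_mult')
    then have "u mod p = 0"
      using min[of "u mod p"] degree_mod_less[of p u] p by (meson not_le)
    then show "p dvd u" by (rule mod_0_imp_dvd)
  next
    assume "p dvd u"
    then show "ratfun_subst u s \<in> M" using p by (auto intro!: M_mult' elim!: dvdE)
  qed
  then show ?thesis by blast
qed

text \<open>Cancel the generator p of the polynomials vanishing at the place; it is no unit because
  1 is not in M. Numerator and denominator then cannot both vanish there, so the behaviour of z is
  visible from the fraction.\<close>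

lemma reduced_quotient:
  assumes "z \<in> ratfun_subfield s"
  obtains u v where "ratfun_subst v s \<noteq> 0" "z = ratfun_subst u s / ratfun_subst v s"
    "ratfun_subst u s \<notin> M \<or> ratfun_subst v s \<notin> M"
proof -
  obtain p where p: "\<And>u. ratfun_subst u s \<in> M \<longleftrightarrow> p dvd u"
    using vanishing_ideal_generator by blast
  have "\<not> is_unit p" using p[of 1] by simp
  from ratfun_subfield_reduced[OF assms this] show ?thesis using that p by metis
qed

end

text \<open>A place where s is finite is determined by the polynomials in s that it contains. For z
  in M with reduced fraction u(s)/v(s), the product u(s) = z v(s) is in M, so v(s) is a unit; by
  hypothesis the same holds at the second place, which therefore contains z.\<close>

lemma nonunits_eqI:
  assumes "ratfun_place s V" "ratfun_place s V'"
    and eq: "\<And>u. ratfun_subst u s \<in> nonunits V \<longleftrightarrow> ratfun_subst u s \<in> nonunits V'"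
  shows "nonunits V = nonunits V'"
proof -
  have "z \<in> nonunits V'" if "ratfun_place s V" "ratfun_place s V'" and z: "z \<in> nonunits V"
    and eq: "\<And>u. ratfun_subst u s \<in> nonunits V \<longleftrightarrow> ratfun_subst u s \<in> nonunits V'" for V V' z
  proof -
    interpret A: ratfun_place s V by fact
    interpret B: ratfun_place s V' by fact
    have "z \<in> ratfun_subfield s" using z A.M_sub A.V_sub by auto
    then obtain u v where uv: "ratfun_subst v s \<noteq> 0" "z = ratfun_subst u s / ratfun_subst v s"
      "ratfun_subst u s \<notin> nonunits V \<or> ratfun_subst v s \<notin> nonunits V"
      by (rule A.reduced_quotient)
    have "ratfun_subst u s = z * ratfun_subst v s" using uv by simp
    then have u: "ratfun_subst u s \<in> nonunits V" using z by (auto intro!: A.M_mult')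
    with uv have "ratfun_subst v s \<notin> nonunits V" by simp
    then have "ratfun_subst u s \<in> nonunits V'" "ratfun_subst v s \<notin> nonunits V'" using u eq by auto
    then show ?thesis
      unfolding uv divide_inverse using B.unit_V[of "ratfun_subst v s"] by (intro B.M_mult') auto
  qed
  then show ?thesis using assms by blast
qed

abbreviation constants :: "'a::field poly fract set" where "constants \<equiv> range ratfun_const"

lemma places_ratfun_subfield_iff:
  "P \<in> places constants (ratfun_subfield s) \<longleftrightarrow>
    (\<exists>V. valuation_ring constants (ratfun_subfield s) V \<and> P = nonunits V)"
  by (simp add: places_def place_of_iff subfield_ratfun_subfield)

lemma ratfun_placeI:
  assumes "valuation_ring constants (ratfun_subfield s) V" "s - ratfun_const c \<in> nonunits V"
  shows "ratfun_place s V"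
proof -
  interpret valued_field constants "ratfun_subfield s" V
    using assms by (intro valued_field.intro subfield_ratfun_subfield)
  have "ratfun_const c \<in> V" using k_sub by auto
  then have "s \<in> V" using V_closed(5)[OF M_sub[OF assms(2)], of "ratfun_const c"] by simp
  then show ?thesis by unfold_locales
qed

text \<open>Once s - c is in the ideal, u(s) is in it iff u(c) = 0, a condition that does not
  mention the place.\<close>

lemma place_unique:
  assumes "P \<in> places constants (ratfun_subfield s)" "P' \<in> places constants (ratfun_subfield s)"
    and "s - ratfun_const c \<in> P" "s - ratfun_const c \<in> P'"
  shows "P = P'"
proof -
  obtain V V' where V: "valuation_ring constants (ratfun_subfield s) V" "P = nonunits V"
    "valuation_ring constants (ratfun_subfield s) V'" "P' = nonunits V'"
    using assms(1,2) unfolding places_ratfun_subfield_iff by blast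
  have "ratfun_place s V" "ratfun_place s V'"
    using V assms ratfun_placeI by blast+
  then show ?thesis
    using assms(3,4) unfolding V(2,4) by (intro nonunits_eqI) (auto simp: ratfun_place.subst_in_M_iff)
qed

text \<open>The residue of a reduced fraction u(s)/v(s) is the constant u(c)/v(c). If v(s) were in
  M, so would be u(s) = z v(s), against reducedness; hence v(c) is nonzero.\<close>

lemma place_rational:
  assumes "P \<in> places constants (ratfun_subfield s)" "s - ratfun_const c \<in> P"
  shows "P \<in> rational_places constants (ratfun_subfield s)"
proof -
  obtain V where V: "valuation_ring constants (ratfun_subfield s) V" "P = nonunits V"
    using assms unfolding places_ratfun_subfield_iff by blast
  interpret ratfun_place s V
    using V assms by (auto intro!: ratfun_placeI)
  have "\<exists>b. z - ratfun_const b \<in> nonunits V" if z: "z \<in> V" for z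
  proof -
    have "z \<in> ratfun_subfield s" using z V_sub by auto
    then obtain u v where uv: "ratfun_subst v s \<noteq> 0" "z = ratfun_subst u s / ratfun_subst v s"
      "ratfun_subst u s \<notin> M \<or> ratfun_subst v s \<notin> M"
      by (rule reduced_quotient)
    have "ratfun_subst u s = z * ratfun_subst v s" using uv by simp
    then have vM: "ratfun_subst v s \<notin> M" using M_mult[OF z] uv by metis
    have pv: "poly v c \<noteq> 0" using vM subst_in_M_iff assms V by simp
    define b where "b = poly u c / poly v c"
    have "poly (u - smult b v) c = 0" using pv by (simp add: b_def)
    then have "ratfun_subst (u - smult b v) s \<in> M" using assms V by (subst subst_in_M_iff) auto
    then have "ratfun_subst (u - smult b v) s * inverse (ratfun_subst v s) \<in> M"
      using unit_V[OF subst_in_V vM] by (intro M_mult') auto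
    also have "ratfun_subst (u - smult b v) s * inverse (ratfun_subst v s) = z - ratfun_const b"
      using uv by (simp add: field_simps)
    finally show ?thesis ..
  qed
  then show ?thesis
    using V by (auto simp: rational_places_def place_of_iff subfield_ratfun_subfield)
qed

section \<open>Restriction of places and the value of a function at a place\<close>

lemma restrict_valuation_ring:
  assumes V: "valuation_ring k UNIV V" and F: "subfield F (ring_of_type_algebra :: 'b::field ring)"
    and k: "k \<subseteq> F" "\<And>a. a \<in> k \<Longrightarrow> inverse a \<in> k"
    and w: "w \<in> F" "w \<in> nonunits V" "w \<noteq> 0"
  shows "valuation_ring k F (V \<inter> F)" and "nonunits (V \<inter> F) = nonunits V \<inter> F"
proof -
  interpret ring "ring_of_type_algebra :: 'b ring" by (rule ring_type_algebra)
  have Finv: "a \<in> F \<Longrightarrow> inverse a \<in> F" for a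
    using F by (simp add: subfield_type_algebra_iff)
  have kV: "k \<subset> V" and subV: "subring V (ring_of_type_algebra :: 'b ring)"
    and or: "\<And>z. z \<in> V \<or> inverse z \<in> V"
    using V by (auto simp: valuation_ring_def)
  \<comment> \<open>w witnesses both proper inclusions: it is in V but not in k, since nonzero
    elements of k are units of V; its inverse is in F but not in V.\<close>
  have "w \<notin> k"
    using w k kV by (auto simp: nonunits_def)
  moreover have "w \<in> V" "inverse w \<notin> V" using w by (auto simp: nonunits_def)
  moreover have "subring (V \<inter> F) (ring_of_type_algebra :: 'b ring)"
    using subV subfieldE(1)[OF F] by (rule subring_inter)
  ultimately show "valuation_ring k F (V \<inter> F)"
    unfolding valuation_ring_def using or Finv w(1) k(1) kV by blast
  show "nonunits (V \<inter> F) = nonunits V \<inter> F"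
    using Finv by (auto simp: nonunits_def)
qed

text \<open>A relation and not a function, because h need not have a value: at a place of higher
  degree its residue may be neither infinite nor a constant.\<close>

definition place_value :: "'a::field poly fract \<Rightarrow> 'a poly fract set \<Rightarrow> 'a proj_line \<Rightarrow> bool" where
  "place_value h Q t \<longleftrightarrow>
    (case t of Affine c \<Rightarrow> h - ratfun_const c \<in> Q | Infinity \<Rightarrow> inverse h \<in> Q)"

lemma place_value_simps [simp]:
  "place_value h Q (Affine c) \<longleftrightarrow> h - ratfun_const c \<in> Q"
  "place_value h Q Infinity \<longleftrightarrow> inverse h \<in> Q"
  by (simp_all add: place_value_def)

text \<open>The value \<open>Infinity\<close> of h is the value 0 of \<open>inverse h\<close>, which
  generates the same subfield.\<close>

lemma place_value_unique:
  assumes "P \<in> places constants (ratfun_subfield h)" "P' \<in> places constants (ratfun_subfield h)"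
    and "place_value h P t" "place_value h P' t"
  shows "P = P'"
proof (cases t)
  case (Affine c)
  with assms place_unique[of P h P' c] show ?thesis by simp
next
  case Infinity
  with assms place_unique[of P "inverse h" P' 0] show ?thesis
    by (simp add: ratfun_subfield_inverse)
qed

lemma place_value_rational:
  assumes "P \<in> places constants (ratfun_subfield h)" "place_value h P t"
  shows "P \<in> rational_places constants (ratfun_subfield h)"
proof (cases t)
  case (Affine c)
  with assms place_rational[of P h c] show ?thesis by simp
next
  case Infinity
  with assms place_rational[of P "inverse h" 0] show ?thesis
    by (simp add: ratfun_subfield_inverse)
qed

text \<open>The case h = 0 has to be excluded: as \<open>inverse 0 = 0\<close>, the zero function
  would have both values \<open>Affine 0\<close> and \<open>Infinity\<close>.\<close>

lemma place_value_inj: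
  assumes P: "P \<in> places constants (ratfun_subfield s)" and h: "h \<in> ratfun_subfield s" "h \<noteq> 0"
    and t: "place_value h P t" "place_value h P t'"
  shows "t = t'"
proof -
  obtain V where V: "valuation_ring constants (ratfun_subfield s) V" "P = nonunits V"
    using P unfolding places_ratfun_subfield_iff by blast
  interpret valued_field constants "ratfun_subfield s" V
    using V by (intro valued_field.intro subfield_ratfun_subfield)
  have cV: "ratfun_const c \<in> V" for c using k_sub by auto
  have c: "c = c'" if "h - ratfun_const c \<in> M" "h - ratfun_const c' \<in> M" for c c'
  proof -
    have "ratfun_const (c' - c) \<in> M" using M_diff[OF that] by simp
    then have "c' - c = 0" using cV[of "inverse (c' - c)"] by (auto simp: nonunits_def)
    then show ?thesis by simp
  qed
  have i: False if "h - ratfun_const c \<in> M" "inverse h \<in> M" for c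
  proof -
    have "h \<in> V" using V_closed(5)[OF M_sub[OF that(1)] cV[of c]] by simp
    then show False using that(2) h by (auto simp: nonunits_def)
  qed
  show ?thesis
    using t V c i by (cases t; cases t') auto
qed

lemma rational_place_value:
  assumes "P \<in> rational_places constants (ratfun_subfield h)"
  obtains t where "place_value h P t"
proof -
  obtain V where V: "valuation_ring constants (ratfun_subfield h) V" "P = nonunits V"
    "\<forall>z\<in>V. \<exists>c\<in>constants. z - c \<in> P"
    using assms by (auto simp: rational_places_def place_of_iff subfield_ratfun_subfield)
  interpret valued_field constants "ratfun_subfield h" V
    using V by (intro valued_field.intro subfield_ratfun_subfield)
  show ?thesis
  proof (cases "h \<in> V")
    case True
    then obtain c where "h - ratfun_const c \<in> P" using V by blast
    then show ?thesis using that[of "Affine c"] by simp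
  next
    case False
    then have "inverse h \<in> P" using V inverse_in_M[of h] by simp
    then show ?thesis using that[of Infinity] by simp
  qed
qed

lemma restrict_place:
  assumes h: "h \<notin> constants" and Q: "Q \<in> places constants UNIV" and t: "place_value h Q t"
  shows "Q \<inter> ratfun_subfield h \<in> places constants (ratfun_subfield h)"
    and "place_value h (Q \<inter> ratfun_subfield h) t"
proof -
  let ?K = "ratfun_subfield h"
  obtain V where V: "valuation_ring constants UNIV V" "Q = nonunits V"
    using Q places_ratfun_subfield_iff[of Q ratfun_X] unfolding ratfun_subfield_X by blast
  have h0: "h \<noteq> 0" using h by (metis ratfun_const_hom(1) rangeI)
  \<comment> \<open>The element of F(h) that vanishes at Q. It is nonzero because h is not constant,
    so the restricted ring remains strictly between the constants and F(h).\<close>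
  define w where "w = (case t of Affine c \<Rightarrow> h - ratfun_const c | Infinity \<Rightarrow> inverse h)"
  have w: "w \<in> ?K" "w \<in> nonunits V" "w \<noteq> 0"
    using t V h h0 by (auto simp: w_def place_value_def intro!: ratfun_subfield_closed split: proj_line.splits)
  have sub: "constants \<subseteq> ?K" by auto
  have inv: "inverse a \<in> constants" if "a \<in> constants" for a :: "'a poly fract"
  proof -
    from that obtain c where "a = ratfun_const c" by auto
    then have "inverse a = ratfun_const (inverse c)" by simp
    then show ?thesis by blast
  qed
  note * = restrict_valuation_ring[OF V(1) subfield_ratfun_subfield sub inv w]
  show "Q \<inter> ?K \<in> places constants ?K"
    unfolding places_ratfun_subfield_iff using * V by metis
  show "place_value h (Q \<inter> ?K) t"
    using t by (auto simp: place_value_def intro!: ratfun_subfield_closed split: proj_line.splits)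
qed

text \<open>The restriction of Q to F(h) is a place with the value of Q, and only one place of F(h)
  has that value. Lying over P is thus the same as sharing its value.\<close>

lemma places_over_eq:
  assumes h: "h \<notin> constants" and P: "P \<in> places constants (ratfun_subfield h)" and t: "place_value h P t"
  shows "places_over constants UNIV P = {Q \<in> places constants UNIV. place_value h Q t}"
proof -
  have "P \<subseteq> Q \<longleftrightarrow> place_value h Q t" if "Q \<in> places constants UNIV" for Q
  proof
    assume "P \<subseteq> Q"
    then show "place_value h Q t" using t by (auto simp: place_value_def split: proj_line.splits)
  next
    assume "place_value h Q t"
    from restrict_place[OF h that this] place_value_unique[OF P _ t] show "P \<subseteq> Q" by blast
  qed
  then show ?thesis by (auto simp: places_over_def)
qed

text \<open>A rational place of F(h) has a value and is determined by it. Conversely, a value t with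
  deg h > 0 places of F(x) comes from a place of F(h): restrict any one of them.\<close>

lemma card_T1_split:
  assumes h: "h \<notin> constants" and deg: "ratfun_degree h > 0"
  shows "card (T1_split h) =
    card {t. card {Q \<in> places constants UNIV. place_value h Q t} = ratfun_degree h}"
    (is "_ = card ?B")
proof -
  have h0: "h \<noteq> 0" using h by (metis ratfun_const_hom(1) rangeI)
  have rat: "P \<in> places constants (ratfun_subfield h)"
    if "P \<in> rational_places constants (ratfun_subfield h)" for P
    using that by (auto simp: rational_places_def places_def)
  have "\<forall>P\<in>T1_split h. \<exists>t. t \<in> ?B \<and> place_value h P t"
  proof
    fix P assume P: "P \<in> T1_split h"
    then have Pr: "P \<in> rational_places constants (ratfun_subfield h)" by (simp add: T1_split_def)
    then obtain t where "place_value h P t" by (rule rational_place_value)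
    with P places_over_eq[OF h rat[OF Pr]] show "\<exists>t. t \<in> ?B \<and> place_value h P t"
      by (auto simp: T1_split_def)
  qed
  from bchoice[OF this]
  obtain f where f: "\<And>P. P \<in> T1_split h \<Longrightarrow> f P \<in> ?B \<and> place_value h P (f P)"
    by blast
  have "bij_betw f (T1_split h) ?B"
  proof (rule bij_betw_imageI)
    show "inj_on f (T1_split h)"
    proof (rule inj_onI)
      fix P P' assume *: "P \<in> T1_split h" "P' \<in> T1_split h" "f P = f P'"
      then show "P = P'"
        using f[of P] f[of P'] by (intro place_value_unique[of P h P' "f P"] rat) (auto simp: T1_split_def)
    qed
    show "f ` T1_split h = ?B"
    proof
      show "f ` T1_split h \<subseteq> ?B" using f by blast
      show "?B \<subseteq> f ` T1_split h"
      proof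
        fix t assume t: "t \<in> ?B"
        then have "{Q \<in> places constants UNIV. place_value h Q t} \<noteq> {}" using deg by fastforce
        then obtain Q where Q: "Q \<in> places constants UNIV" "place_value h Q t" by blast
        define P where "P = Q \<inter> ratfun_subfield h"
        have P: "P \<in> places constants (ratfun_subfield h)" "place_value h P t"
          using restrict_place[OF h Q] by (simp_all add: P_def)
        have "P \<in> T1_split h"
          unfolding T1_split_def using place_value_rational[OF P] places_over_eq[OF h P] t by simp
        moreover have "f P = t"
          using place_value_inj[OF P(1) _ h0 _ P(2)] f[OF calculation] by auto
        ultimately show "t \<in> f ` T1_split h" by blast
      qed
    qed
  qed
  then show ?thesis by (rule bij_betw_same_card)
qed

subsection \<open>Places of the rational function field\<close>

definition transcendental :: "'a::field poly fract \<Rightarrow> bool" where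
  "transcendental s \<longleftrightarrow> (\<forall>v. ratfun_subst v s = 0 \<longrightarrow> v = 0)"

lemma transcendental_X: "transcendental ratfun_X"
  by (auto simp: transcendental_def ratfun_subst_X Zero_fract_def eq_fract)

text \<open>Multiplying v(1/s) by a power of s gives the reversed polynomial at s.\<close>

lemma transcendental_inverse:
  assumes "transcendental s"
  shows "transcendental (inverse s)"
  unfolding transcendental_def
proof (intro allI impI)
  fix v assume v: "ratfun_subst v (inverse s) = 0"
  have s: "s \<noteq> 0" using assms[unfolded transcendental_def, rule_format, of "[:0, 1:]"] by auto
  have rp: "map_poly ratfun_const (reflect_poly v) = reflect_poly (map_poly ratfun_const v)"
    by (rule poly_eqI) (auto simp: coeff_map_poly coeff_reflect_poly degree_map_poly)
  have "ratfun_subst (reflect_poly v) s = s ^ Polynomial.degree v * ratfun_subst v (inverse s)"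
    unfolding ratfun_subst_def rp using s by (subst poly_reflect_poly_nz) (auto simp: degree_map_poly)
  then have "reflect_poly v = 0" using v assms by (auto simp: transcendental_def)
  then show "v = 0" by simp
qed

lemma transcendental_subst_eq_iff:
  "transcendental s \<Longrightarrow> ratfun_subst u s = ratfun_subst v s \<longleftrightarrow> u = v"
  unfolding transcendental_def by (metis eq_iff_diff_eq_0 ratfun_subst_diff)

definition local_ring :: "'a::field poly fract \<Rightarrow> 'a \<Rightarrow> 'a poly fract set" where
  "local_ring s c = {ratfun_subst u s / ratfun_subst v s | u v. poly v c \<noteq> 0}"

text \<open>Membership allows any representing fraction. If u'/v' is another one with v'(c) nonzero,
  transcendence gives u v' = u' v as polynomials; at c, v(c) = 0 would force u(c) = 0.\<close>

lemma local_ring_iff: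
  assumes s: "transcendental s" and v: "v \<noteq> 0" and uv: "poly u c \<noteq> 0 \<or> poly v c \<noteq> 0"
  shows "ratfun_subst u s / ratfun_subst v s \<in> local_ring s c \<longleftrightarrow> poly v c \<noteq> 0"
proof
  assume "ratfun_subst u s / ratfun_subst v s \<in> local_ring s c"
  then obtain u' v' where *: "poly v' c \<noteq> 0"
    "ratfun_subst u s / ratfun_subst v s = ratfun_subst u' s / ratfun_subst v' s"
    by (auto simp: local_ring_def)
  then have "v' \<noteq> 0" by auto
  then have "ratfun_subst (u * v') s = ratfun_subst (u' * v) s"
    using * s v by (simp add: transcendental_def frac_eq_eq) (metis (no_types, lifting) frac_eq_eq)
  then have "u * v' = u' * v" using transcendental_subst_eq_iff[OF s, of "u * v'" "u' * v"] by blast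
  then have "poly u c * poly v' c = poly u' c * poly v c" by (metis poly_mult)
  then show "poly v c \<noteq> 0" using * uv by auto
qed (auto simp: local_ring_def)

lemma nonunits_local_ring_iff:
  assumes s: "transcendental s" and v: "poly v c \<noteq> 0"
  shows "ratfun_subst u s / ratfun_subst v s \<in> nonunits (local_ring s c) \<longleftrightarrow> poly u c = 0"
proof (cases "u = 0")
  case True
  moreover have "0 \<in> local_ring s c"
    unfolding local_ring_def by (intro CollectI exI[of _ 0] exI[of _ 1]) simp
  ultimately show ?thesis by (simp add: nonunits_def)
next
  case False
  moreover have "v \<noteq> 0" using v by auto
  ultimately have nz: "ratfun_subst u s \<noteq> 0" "ratfun_subst v s \<noteq> 0"
    using s by (auto simp: transcendental_def)
  have "ratfun_subst u s / ratfun_subst v s \<in> local_ring s c"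
    using v by (auto simp: local_ring_def)
  moreover have "ratfun_subst v s / ratfun_subst u s \<in> local_ring s c \<longleftrightarrow> poly u c \<noteq> 0"
    using s False v by (intro local_ring_iff) auto
  ultimately show ?thesis using nz by (auto simp: nonunits_def)
qed

lemma subst_in_local_ring: "ratfun_subst u s \<in> local_ring s c"
  unfolding local_ring_def by (intro CollectI exI[of _ u] exI[of _ 1]) simp

lemma valuation_ring_local_ring:
  assumes s: "transcendental s"
  shows "valuation_ring constants (ratfun_subfield s) (local_ring s c)"
  unfolding valuation_ring_def subring_type_algebra_iff
proof (intro conjI ballI)
  show "1 \<in> local_ring s c" using subst_in_local_ring[of 1 s c] by simp
  fix a assume a: "a \<in> local_ring s c"
  then obtain u v where uv: "poly v c \<noteq> 0" "a = ratfun_subst u s / ratfun_subst v s"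
    by (auto simp: local_ring_def)
  show "- a \<in> local_ring s c"
    unfolding local_ring_def using uv by (intro CollectI exI[of _ "- u"] exI[of _ v]) simp
  fix b assume b: "b \<in> local_ring s c"
  then obtain u' v' where uv': "poly v' c \<noteq> 0" "b = ratfun_subst u' s / ratfun_subst v' s"
    by (auto simp: local_ring_def)
  show "a * b \<in> local_ring s c"
    unfolding local_ring_def using uv uv' by (intro CollectI exI[of _ "u * u'"] exI[of _ "v * v'"]) simp
  have "v \<noteq> 0" "v' \<noteq> 0" using uv uv' by auto
  then have "ratfun_subst v s \<noteq> 0" "ratfun_subst v' s \<noteq> 0" using s by (auto simp: transcendental_def)
  then show "a + b \<in> local_ring s c"
    unfolding local_ring_def using uv uv'
    by (intro CollectI exI[of _ "u * v' + u' * v"] exI[of _ "v * v'"]) (simp add: add_frac_eq)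
next
  have "ratfun_const b \<in> local_ring s c" for b
    using subst_in_local_ring[of "[:b:]" s c] by simp
  moreover have "s \<in> local_ring s c"
    using subst_in_local_ring[of "[:0, 1:]" s c] by simp
  moreover have "s \<notin> constants"
    using s[unfolded transcendental_def, rule_format, of "[:- b, 1:]" for b] by auto
  ultimately show "constants \<subset> local_ring s c" by blast
next
  have "local_ring s c \<subseteq> ratfun_subfield s"
    by (auto simp: local_ring_def intro!: ratfun_subfield_closed ratfun_subst_in_subfield)
  \<comment> \<open>The function 1/(s - c), with its pole at s = c, shows that the ring is not the
    whole field.\<close>
  moreover have "ratfun_subst 1 s / ratfun_subst [:- c, 1:] s \<in> ratfun_subfield s"
    by (intro ratfun_subfield_closed ratfun_subst_in_subfield) simp_all
  moreover have "ratfun_subst 1 s / ratfun_subst [:- c, 1:] s \<notin> local_ring s c"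
    using s by (subst local_ring_iff) auto
  ultimately show "local_ring s c \<subset> ratfun_subfield s" by blast
next
  fix z assume "z \<in> ratfun_subfield s"
  \<comment> \<open>Cancelling X - c leaves a fraction with u(c) or v(c) nonzero, so z or its
    inverse is regular at c.\<close>
  moreover have "\<not> is_unit [:- c, 1:]" by (simp add: is_unit_iff_degree)
  ultimately obtain u v where uv: "z = ratfun_subst u s / ratfun_subst v s"
      "\<not> [:- c, 1:] dvd u \<or> \<not> [:- c, 1:] dvd v"
    by (rule ratfun_subfield_reduced) 
  then have "poly u c \<noteq> 0 \<or> poly v c \<noteq> 0" by (simp add: poly_eq_0_iff_dvd)
  then show "z \<in> local_ring s c \<or> inverse z \<in> local_ring s c"
    unfolding uv local_ring_def by (auto intro: exI[of _ u] exI[of _ v])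
qed

section \<open>The places of the points of the projective line\<close>

definition point_place :: "'a::field proj_line \<Rightarrow> 'a poly fract set" where
  "point_place P = nonunits
    (case P of Affine a \<Rightarrow> local_ring ratfun_X a | Infinity \<Rightarrow> local_ring (inverse ratfun_X) 0)"

lemma point_place_simps:
  "point_place (Affine a) = nonunits (local_ring ratfun_X a)"
  "point_place Infinity = nonunits (local_ring (inverse ratfun_X) 0)"
  by (simp_all add: point_place_def)

lemma point_place_in_places: "point_place P \<in> places constants UNIV"
proof (cases P)
  case (Affine a)
  then show ?thesis
    using valuation_ring_local_ring[OF transcendental_X, of a] places_ratfun_subfield_iff[of _ ratfun_X]
    by (auto simp: point_place_simps ratfun_subfield_X)
next
  case Infinity
  then show ?thesis
    using valuation_ring_local_ring[OF transcendental_inverse[OF transcendental_X], of 0]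
      places_ratfun_subfield_iff[of _ "inverse ratfun_X"]
    by (auto simp: point_place_simps ratfun_subfield_X ratfun_subfield_inverse)
qed

lemma quotient_in_point_place_Affine_iff:
  "poly v a \<noteq> 0 \<Longrightarrow>
    ratfun_subst u ratfun_X / ratfun_subst v ratfun_X \<in> point_place (Affine a) \<longleftrightarrow> poly u a = 0"
  by (simp add: point_place_simps nonunits_local_ring_iff transcendental_X)

lemma quotient_in_point_place_Infinity_iff:
  "poly v 0 \<noteq> 0 \<Longrightarrow>
    ratfun_subst u (inverse ratfun_X) / ratfun_subst v (inverse ratfun_X) \<in> point_place Infinity
      \<longleftrightarrow> poly u 0 = 0"
  by (simp add: point_place_simps nonunits_local_ring_iff transcendental_X transcendental_inverse)

lemma place_value_X_point_place: "place_value ratfun_X (point_place P) P"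
proof (cases P)
  case (Affine a)
  then show ?thesis
    using quotient_in_point_place_Affine_iff[of 1 a "[:- a, 1:]"] by simp
next
  case Infinity
  then show ?thesis
    using quotient_in_point_place_Infinity_iff[of 1 "[:0, 1:]"] by simp
qed

lemma ratfun_X_nonzero [simp]: "ratfun_X \<noteq> 0"
  by (simp add: ratfun_X_def Zero_fract_def eq_fract)

lemma point_place_eqI:
  assumes "Q \<in> places constants UNIV" "place_value ratfun_X Q P"
  shows "Q = point_place P"
  using place_value_unique[of Q ratfun_X "point_place P" P] assms
  by (simp add: ratfun_subfield_X point_place_in_places place_value_X_point_place)

lemma place_value_inj_UNIV:
  "Q \<in> places constants UNIV \<Longrightarrow> h \<noteq> 0 \<Longrightarrow> place_value h Q t \<Longrightarrow> place_value h Q t' \<Longrightarrow> t = t'"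
  using place_value_inj[of Q ratfun_X h t t'] by (simp add: ratfun_subfield_X)

lemma inj_point_place: "inj point_place"
proof (rule injI)
  fix P P' :: "'a proj_line" assume "point_place P = point_place P'"
  then show "P = P'"
    using place_value_inj_UNIV[OF point_place_in_places[of P] ratfun_X_nonzero, of P P']
      place_value_X_point_place[of P] place_value_X_point_place[of P'] by simp
qed

lemma place_value_quotient_point_place:
  assumes "poly u a \<noteq> 0 \<or> poly v a \<noteq> 0"
  shows "place_value (ratfun_subst u ratfun_X / ratfun_subst v ratfun_X) (point_place (Affine a))
    (if poly v a = 0 then Infinity else Affine (poly u a / poly v a))"
proof (cases "poly v a = 0")
  case True
  then show ?thesis using assms quotient_in_point_place_Affine_iff[of u a v] by simp
next
  case False
  define c where "c = poly u a / poly v a"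
  have "v \<noteq> 0" using False by auto
  then have v: "ratfun_subst v ratfun_X \<noteq> 0" using transcendental_X by (auto simp: transcendental_def)
  have "ratfun_subst (u - smult c v) ratfun_X / ratfun_subst v ratfun_X \<in> point_place (Affine a)"
    using False by (subst quotient_in_point_place_Affine_iff) (auto simp: c_def)
  then show ?thesis using False v by (simp add: diff_divide_distrib flip: c_def)
qed

lemma ratfun_place_X:
  assumes "Q \<in> places constants UNIV" "inverse ratfun_X \<notin> Q"
  obtains V where "ratfun_place ratfun_X V" "Q = nonunits V"
proof -
  obtain V where V: "valuation_ring constants UNIV V" "Q = nonunits V"
    using assms(1) places_ratfun_subfield_iff[of Q ratfun_X] unfolding ratfun_subfield_X by blast
  interpret valued_field constants "ratfun_subfield ratfun_X" V
    using V by (intro valued_field.intro subfield_ratfun_subfield) (simp add: ratfun_subfield_X)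
  have "ratfun_X \<in> V" using inverse_in_M[of ratfun_X] assms V by auto
  then have "ratfun_place ratfun_X V" by unfold_locales
  then show ?thesis using that V by blast
qed

section \<open>Places at which a polynomial vanishes\<close>

lemma prime_elem_dvd_prod:
  assumes "prime_elem p" "finite A" "p dvd (\<Prod>i\<in>A. f i)"
  shows "\<exists>i\<in>A. p dvd f i"
  using assms(2,3)
proof (induction A rule: finite_induct)
  case empty
  then show ?case using assms(1) by (simp add: prime_elem_def)
next
  case (insert i A)
  then show ?case using assms(1) by (auto simp: prime_elem_dvd_mult_iff)
qed

text \<open>
  The polynomials vanishing at a place where \<open>x\<close> is finite form a prime ideal. Distinct places give
  coprime generators, and their product divides every polynomial vanishing at all these places.
\<close>

lemma places_of_polynomial:
  fixes u :: "'a::field poly"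
  assumes u: "u \<noteq> 0"
  defines "A \<equiv> {Q \<in> places constants UNIV. inverse ratfun_X \<notin> Q \<and> ratfun_subst u ratfun_X \<in> Q}"
  shows "finite A" and "card A \<le> Polynomial.degree u"
    and "card A = Polynomial.degree u \<Longrightarrow> Q \<in> A \<Longrightarrow> \<exists>a. Q = point_place (Affine a)"
proof -
  have "\<exists>p. prime_elem p \<and> (\<forall>v. ratfun_subst v ratfun_X \<in> Q \<longleftrightarrow> p dvd v)" if Q: "Q \<in> A" for Q
  proof -
    obtain V where V: "ratfun_place ratfun_X V" "Q = nonunits V"
      using Q ratfun_place_X[of Q] by (auto simp: A_def)
    interpret ratfun_place ratfun_X V by fact
    obtain p where p: "\<And>v. ratfun_subst v ratfun_X \<in> Q \<longleftrightarrow> p dvd v"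
      using vanishing_ideal_generator V by blast
    have "prime_elem p"
    proof (rule prime_elemI)
      show "p \<noteq> 0" using p[of u] u Q by (auto simp: A_def)
      show "\<not> is_unit p" using p[of 1] V by simp
      show "p dvd a \<or> p dvd b" if "p dvd a * b" for a b
        using that p[of "a * b"] p[of a] p[of b] V
          M_prime[of "ratfun_subst a ratfun_X" "ratfun_subst b ratfun_X"] by simp
    qed
    with p show ?thesis by blast
  qed
  then obtain p where p: "\<And>Q. Q \<in> A \<Longrightarrow> prime_elem (p Q)"
    "\<And>Q v. Q \<in> A \<Longrightarrow> ratfun_subst v ratfun_X \<in> Q \<longleftrightarrow> p Q dvd v"
    by metis
  have distinct: "Q = Q'" if Q: "Q \<in> A" "Q' \<in> A" "p Q dvd p Q'" for Q Q'
  proof -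
    \<comment> \<open>A prime dividing a prime is associated to it, so both places contain the same
      polynomials in x and coincide.\<close>
    have "p Q' dvd p Q"
      using p(1)[OF Q(1)] p(1)[OF Q(2)] Q(3)
      by (meson irreducibleD' prime_elem_imp_irreducible prime_elem_not_unit)
    then have eq: "ratfun_subst v ratfun_X \<in> Q \<longleftrightarrow> ratfun_subst v ratfun_X \<in> Q'" for v
      using p(2)[OF Q(1)] p(2)[OF Q(2)] Q(3) dvd_trans by metis
    have QA: "Q \<in> places constants UNIV" "inverse ratfun_X \<notin> Q"
      "Q' \<in> places constants UNIV" "inverse ratfun_X \<notin> Q'"
      using Q by (simp_all add: A_def)
    obtain V where V: "ratfun_place ratfun_X V" "Q = nonunits V"
      using QA(1,2) by (rule ratfun_place_X)
    obtain V' where V': "ratfun_place ratfun_X V'" "Q' = nonunits V'"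
      using QA(3,4) by (rule ratfun_place_X)
    show ?thesis
      using eq unfolding V(2) V'(2) by (rule nonunits_eqI[OF V(1) V'(1)])
  qed
  have dvd: "(\<Prod>Q\<in>B. p Q) dvd u" if "finite B" "B \<subseteq> A" for B
    using that
  proof (induction B rule: finite_induct)
    case (insert Q B)
    then obtain m where m: "u = (\<Prod>Q\<in>B. p Q) * m" by (auto elim!: dvdE)
    have pr: "prime_elem (p Q)" using insert p by auto
    have "p Q dvd u" using p(2)[of Q u] insert by (auto simp: A_def)
    moreover have "\<not> p Q dvd (\<Prod>Q\<in>B. p Q)"
    proof
      assume "p Q dvd (\<Prod>Q\<in>B. p Q)"
      then obtain Q' where "Q' \<in> B" "p Q dvd p Q'"
        using prime_elem_dvd_prod[OF pr insert.hyps(1)] by blast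
      then show False using distinct[of Q Q'] insert by auto
    qed
    ultimately have "p Q dvd m" using pr m prime_elem_dvd_mult_iff by blast
    then show ?case unfolding m using insert by (simp add: mult_dvd_mono mult.commute)
  qed simp
  have p0: "p Q \<noteq> 0" and p1: "1 \<le> Polynomial.degree (p Q)" if "Q \<in> A" for Q
  proof -
    show *: "p Q \<noteq> 0" using p(1)[OF that] by auto
    show "1 \<le> Polynomial.degree (p Q)"
      using is_unit_iff_degree[OF *] p(1)[OF that] by (auto simp: Suc_le_eq)
  qed
  have deg: "(\<Sum>Q\<in>B. Polynomial.degree (p Q)) \<le> Polynomial.degree u" if B: "finite B" "B \<subseteq> A" for B
    using dvd_imp_degree_le[OF dvd[OF B] u] p0 B by (subst (asm) degree_prod_eq_sum_degree) auto
  have le: "card B \<le> Polynomial.degree u" if B: "finite B" "B \<subseteq> A" for B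
    using deg[OF B] sum_mono[of B "\<lambda>_. 1" "\<lambda>Q. Polynomial.degree (p Q)"] p1 B by fastforce
  \<comment> \<open>An infinite A would have finite subsets of every size, against the uniform bound
    \<open>le\<close>.\<close>
  show fin: "finite A"
    using le by (metis infinite_arbitrarily_large not_less_eq_eq order_refl)
  show "card A \<le> Polynomial.degree u" using le fin by blast
  show "\<exists>a. Q = point_place (Affine a)" if eq: "card A = Polynomial.degree u" and Q: "Q \<in> A"
  proof -
    \<comment> \<open>The generators have degree at least 1 and their degrees add up to at most deg
      u, which is the number of places. Hence no degree can exceed 1.\<close>
    have "Polynomial.degree (p Q) = 1"
    proof (rule ccontr)
      assume "Polynomial.degree (p Q) \<noteq> 1"
      then have "(\<Sum>Q\<in>A. 1) < (\<Sum>Q\<in>A. Polynomial.degree (p Q))"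
        using p1 Q fin by (intro sum_strict_mono_ex1) (auto intro!: bexI[of _ Q] simp: le_neq_implies_less)
      then show False using deg[of A] fin eq by simp
    qed
    moreover obtain b r where r: "p Q = pCons b r" by (cases "p Q")
    ultimately have "Polynomial.degree r = 0" "r \<noteq> 0" by (auto split: if_splits)
    then obtain c where bc: "p Q = [:b, c:]" "c \<noteq> 0"
      using r by (auto elim: degree_eq_zeroE)
    have "[:b / c, 1:] = smult (1 / c) (p Q)" using bc by simp
    then have "p Q dvd [:b / c, 1:]" by (metis dvd_refl dvd_smult)
    then have "ratfun_subst [:b / c, 1:] ratfun_X \<in> Q" using p(2)[OF Q] by blast
    then have "place_value ratfun_X Q (Affine (- b / c))" by (simp add: add.commute)
    then have "Q = point_place (Affine (- b / c))"
      using Q by (intro point_place_eqI) (simp_all add: A_def)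
    then show ?thesis by blast
  qed
qed

subsection \<open>The fibres of the quartic\<close>

locale quartic =
  fixes d :: "'a::field"
  assumes two_nonzero [simp]: "(2 :: 'a) \<noteq> 0" and d_nonzero [simp]: "d \<noteq> 0"
begin

lemma four_nonzero [simp]: "(4 :: 'a) \<noteq> 0"
  using two_nonzero mult_eq_0_iff[of "2::'a" 2] by simp

lemma ratfun_two_four_nonzero [simp]: "(2 :: 'a poly fract) \<noteq> 0" "(4 :: 'a poly fract) \<noteq> 0"
  using ratfun_const_eq_0_iff[of "2 :: 'a"] ratfun_const_eq_0_iff[of "4 :: 'a"]
  by (simp_all del: ratfun_const_eq_0_iff)

definition numer :: "'a poly" where
  "numer = [:- (d ^ 4), 8 * d ^ 3, - (12 * d ^ 2), 0, 4:]"

definition denom :: "'a poly" where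
  "denom = [:0, 2 * d ^ 2, - (6 * d), 4:]"

definition h :: "'a poly fract" where
  "h = ratfun_subst numer ratfun_X / ratfun_subst denom ratfun_X"

lemma poly_numer: "poly numer a = 4 * a ^ 4 - 12 * d ^ 2 * a ^ 2 + 8 * d ^ 3 * a - d ^ 4"
  by (simp add: numer_def algebra_simps power2_eq_square power4_eq_xxxx)

lemma poly_denom: "poly denom a = 2 * a * (a - d) * (2 * a - d)"
  by (simp add: denom_def algebra_simps power2_eq_square)

lemma subst_numer:
  "ratfun_subst numer s = 4 * s ^ 4 - 12 * ratfun_const d ^ 2 * s ^ 2 + 8 * ratfun_const d ^ 3 * s - ratfun_const d ^ 4"
  by (simp add: numer_def algebra_simps power2_eq_square power4_eq_xxxx)

lemma subst_denom:
  "ratfun_subst denom s = 2 * s * (s - ratfun_const d) * (2 * s - ratfun_const d)"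
  by (simp add: denom_def algebra_simps power2_eq_square)

lemma degree_numer: "Polynomial.degree numer = 4"
  by (simp add: numer_def)

lemma degree_denom: "Polynomial.degree denom = 3"
  by (simp add: denom_def)

text \<open>The cofactors are homogeneous in x and d with integer coefficients and the right-hand
  side is d^6, so the identity shows coprimality in every characteristic at once; it also excludes
  common roots.\<close>

lemma bezout:
  "[:- (d ^ 2), 20 * d, - 20:] * numer + [:14 * d ^ 3, - (54 * d ^ 2), 10 * d, 20:] * denom = [:d ^ 6:]"
  by (simp add: numer_def denom_def algebra_simps power_numeral_reduce power2_eq_square)

lemma coprime_numer_denom: "coprime numer denom"
proof (rule coprimeI)
  fix c assume "c dvd numer" "c dvd denom"
  then have "c dvd [:d ^ 6:]" unfolding bezout[symmetric] by (intro dvd_add dvd_mult)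
  then show "is_unit c" by (rule dvd_trans) (simp add: is_unit_iff_degree)
qed

lemma no_common_root: "poly numer a \<noteq> 0 \<or> poly denom a \<noteq> 0"
proof -
  have "poly [:d ^ 6:] a \<noteq> 0" by simp
  then show ?thesis unfolding bezout[symmetric] by (auto simp del: mult_pCons_left)
qed

text \<open>The factor 1/4 makes the denominator monic, as the leading coefficient of
  \<open>denom\<close> is 4.\<close>

lemma lowest_terms_h: "lowest_terms h = (smult (1 / 4) numer, smult (1 / 4) denom)"
  unfolding lowest_terms_def
proof (rule the1_equality[OF lowest_terms_ex1])
  have "coprime (smult (1 / 4) numer) (smult (1 / 4) denom)"
  proof (rule coprimeI)
    fix c assume "c dvd smult (1 / 4) numer" "c dvd smult (1 / 4) denom"
    then have "c dvd numer" "c dvd denom" by (auto simp: dvd_smult_iff)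
    then show "is_unit c" using coprime_numer_denom coprime_common_divisor by blast
  qed
  moreover have "h = Fract (smult (1 / 4) numer) (smult (1 / 4) denom)"
    unfolding Fract_ratfun_subst h_def by simp
  moreover have "lead_coeff (smult (1 / 4) denom) = 1"
    by (simp add: degree_denom) (simp add: denom_def numeral_3_eq_3)
  ultimately show "coprime (fst (smult (1 / 4) numer, smult (1 / 4) denom))
      (snd (smult (1 / 4) numer, smult (1 / 4) denom)) \<and>
    lead_coeff (snd (smult (1 / 4) numer, smult (1 / 4) denom)) = 1 \<and>
    h = Fract (fst (smult (1 / 4) numer, smult (1 / 4) denom)) (snd (smult (1 / 4) numer, smult (1 / 4) denom))"
    by simp
qed

lemma ratfun_degree_h: "ratfun_degree h = 4"
  by (simp add: ratfun_degree_def lowest_terms_h degree_numer degree_denom)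

lemma eval_h_Affine:
  "ratfun_eval h (Affine a) = (if poly denom a = 0 then Infinity else Affine (poly numer a / poly denom a))"
  by (simp add: ratfun_eval_def lowest_terms_h)

lemma eval_h_Infinity: "ratfun_eval h Infinity = Infinity"
  by (simp add: ratfun_eval_def lowest_terms_h degree_numer degree_denom)

lemma denom_root_iff: "poly denom a = 0 \<longleftrightarrow> a \<in> {0, d, d / 2}"
  by (auto simp: poly_denom eq_divide_eq mult.commute)

lemma denom_X_nonzero [simp]: "ratfun_subst denom ratfun_X \<noteq> 0"
  and numer_X_nonzero [simp]: "ratfun_subst numer ratfun_X \<noteq> 0"
  using degree_numer degree_denom transcendental_X by (auto simp: transcendental_def)

text \<open>The link between the two descriptions of h: evaluation at a point is the residue at the
  place of that point.\<close>

lemma place_value_h_point_place: "place_value h (point_place P) (ratfun_eval h P)"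
proof (cases P)
  case (Affine a)
  then show ?thesis
    using place_value_quotient_point_place[OF no_common_root[of a]]
    by (simp only: eval_h_Affine h_def[symmetric])
next
  case Infinity
  \<comment> \<open>The coefficients of \<open>denom\<close> and \<open>numer\<close> read
    backwards, both taken as polynomials of degree 4. This gives \<open>?u\<close> the constant term
    0, so \<open>inverse h\<close> vanishes at infinity.\<close>
  let ?u = "[:0, 4, - (6 * d), 2 * d ^ 2:]" and ?v = "[:4, 0, - (12 * d ^ 2), 8 * d ^ 3, - (d ^ 4):]"
  let ?x = "ratfun_X :: 'a poly fract"
  have "ratfun_subst denom ?x = ?x ^ 4 * ratfun_subst ?u (inverse ?x)"
    by (simp add: denom_def field_simps power4_eq_xxxx)
  moreover have "ratfun_subst numer ?x = ?x ^ 4 * ratfun_subst ?v (inverse ?x)"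
    by (simp add: numer_def field_simps power4_eq_xxxx)
  ultimately have "inverse h = ratfun_subst ?u (inverse ?x) / ratfun_subst ?v (inverse ?x)"
    unfolding h_def by simp
  then show ?thesis
    using Infinity quotient_in_point_place_Infinity_iff[of ?v ?u] by (simp add: eval_h_Infinity)
qed

lemma h_not_constant: "h \<notin> constants"
proof
  assume "h \<in> constants"
  then obtain c where "h = ratfun_const c" by auto
  then have "ratfun_subst numer ratfun_X = ratfun_subst (smult c denom) ratfun_X"
    by (simp add: h_def field_simps)
  then have "numer = smult c denom" using transcendental_subst_eq_iff[OF transcendental_X] by blast
  then show False using degree_numer degree_denom degree_smult_le[of c denom] by simp
qed

lemma h_nonzero: "h \<noteq> 0"
  by (simp add: h_def)

section \<open>Fibres of rational points against sets of places\<close>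

definition fibre :: "'a proj_line \<Rightarrow> 'a proj_line set" where
  "fibre t = {P. ratfun_eval h P = t}"

definition places_at :: "'a proj_line \<Rightarrow> 'a poly fract set set" where
  "places_at t = {Q \<in> places constants UNIV. place_value h Q t}"

lemma point_place_in_places_at_iff: "point_place P \<in> places_at t \<longleftrightarrow> P \<in> fibre t"
  using place_value_inj_UNIV[OF point_place_in_places h_nonzero place_value_h_point_place, of P t]
    place_value_h_point_place[of P]
  by (auto simp: places_at_def fibre_def point_place_in_places)

lemma card_point_place_fibre: "card (point_place ` fibre t) = card (fibre t)"
  using inj_point_place by (intro card_image) (auto intro: inj_on_subset)

lemma fibre_Infinity: "fibre Infinity = {Infinity, Affine 0, Affine d, Affine (d / 2)}"
proof -
  have "P \<in> fibre Infinity \<longleftrightarrow> P \<in> {Infinity, Affine 0, Affine d, Affine (d / 2)}" for P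
    by (cases P) (auto simp: fibre_def eval_h_Infinity eval_h_Affine denom_root_iff)
  then show ?thesis by blast
qed

lemma card_fibre_Infinity: "card (fibre Infinity) = 4"
proof -
  have "(2 :: 'a) \<noteq> 1" by (metis add_cancel_right_right one_add_one zero_neq_one)
  then have "d * 2 \<noteq> d" by simp
  then have "d \<noteq> d / 2" by (simp add: field_simps)
  then show ?thesis by (auto simp: fibre_Infinity)
qed

text \<open>Where x is finite, 1/h times \<open>numer\<close> is \<open>denom\<close>, a product of
  three linear factors. The place is a prime ideal, so it contains one of them, and that fixes the
  value of x.\<close>

lemma places_at_Infinity: "places_at Infinity = point_place ` fibre Infinity"
proof
  show "point_place ` fibre Infinity \<subseteq> places_at Infinity"
    using point_place_in_places_at_iff by blast
  show "places_at Infinity \<subseteq> point_place ` fibre Infinity"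
  proof
    fix Q assume "Q \<in> places_at Infinity"
    then have Q: "Q \<in> places constants UNIV" "inverse h \<in> Q" by (auto simp: places_at_def)
    show "Q \<in> point_place ` fibre Infinity"
    proof (cases "inverse ratfun_X \<in> Q")
      case True
      then have "Q = point_place Infinity" using Q by (intro point_place_eqI) auto
      then show ?thesis by (simp add: fibre_Infinity)
    next
      case False
      then obtain V where V: "ratfun_place ratfun_X V" "Q = nonunits V"
        using Q by (auto elim: ratfun_place_X)
      interpret ratfun_place ratfun_X V by fact
      have "inverse h * ratfun_subst numer ratfun_X \<in> Q"
        using Q V by (auto intro: M_mult')
      then have "ratfun_subst [:0, 2:] ratfun_X * ratfun_subst [:- d, 1:] ratfun_X
          * ratfun_subst [:- d, 2:] ratfun_X \<in> Q"
        by (simp add: h_def subst_denom mult_ac)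
      then have "ratfun_subst [:0, 2:] ratfun_X \<in> Q \<or> ratfun_subst [:- d, 1:] ratfun_X \<in> Q
          \<or> ratfun_subst [:- d, 2:] ratfun_X \<in> Q"
        unfolding V(2) using M_prime V_closed(4) subst_in_V by meson
      moreover have "ratfun_const (1 / 2 :: 'a) * ratfun_subst [:0, 2:] ratfun_X = ratfun_X - ratfun_const 0"
        "ratfun_const (1 / 2 :: 'a) * ratfun_subst [:- d, 2:] ratfun_X = ratfun_X - ratfun_const (d / 2)"
        "ratfun_const 1 * ratfun_subst [:- d, 1:] ratfun_X = ratfun_X - ratfun_const d"
        by (simp_all add: field_simps)
      ultimately have "\<exists>a\<in>{0, d, d / 2}. ratfun_X - ratfun_const a \<in> Q"
        unfolding V(2) using M_mult[OF const_in_V] by (metis insertI1 insertI2)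
      then show ?thesis
        using Q by (auto simp: fibre_Infinity intro!: point_place_eqI)
    qed
  qed
qed

text \<open>Clearing the denominator in h = c gives \<open>numer\<close> - c \<open>denom\<close>,
  of degree 4 for every c because \<open>denom\<close> has degree 3. A pole of x cannot occur, since
  h is infinite there.\<close>

lemma places_at_Affine_bound:
  shows "finite (places_at (Affine c))" and "card (places_at (Affine c)) \<le> 4"
    and "card (places_at (Affine c)) = 4 \<Longrightarrow> places_at (Affine c) \<subseteq> range point_place"
proof -
  define u where "u = numer - smult c denom"
  have u: "Polynomial.degree u = 4" "u \<noteq> 0"
    by (simp_all add: u_def numer_def denom_def)
  define A where "A = {Q \<in> places constants UNIV. inverse ratfun_X \<notin> Q \<and> ratfun_subst u ratfun_X \<in> Q}"
  have sub: "places_at (Affine c) \<subseteq> A"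
  proof
    fix Q assume "Q \<in> places_at (Affine c)"
    then have Q: "Q \<in> places constants UNIV" "place_value h Q (Affine c)"
      by (auto simp: places_at_def)
    have fin: "inverse ratfun_X \<notin> Q"
    proof
      assume "inverse ratfun_X \<in> Q"
      then have "Q = point_place Infinity" using Q by (intro point_place_eqI) auto
      then have "place_value h Q Infinity"
        using place_value_h_point_place[of Infinity] by (simp add: eval_h_Infinity)
      then show False using place_value_inj_UNIV[OF Q(1) h_nonzero Q(2)] by blast
    qed
    then obtain V where V: "ratfun_place ratfun_X V" "Q = nonunits V"
      using Q by (auto elim: ratfun_place_X)
    interpret ratfun_place ratfun_X V by fact
    have "(h - ratfun_const c) * ratfun_subst denom ratfun_X \<in> Q"
      using Q V by (auto intro!: M_mult')
    also have "(h - ratfun_const c) * ratfun_subst denom ratfun_X = ratfun_subst u ratfun_X"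
      by (simp add: h_def u_def field_simps)
    finally show "Q \<in> A" using Q fin by (simp add: A_def)
  qed
  note A = places_of_polynomial[OF u(2), folded A_def, unfolded u(1)]
  show "finite (places_at (Affine c))" using sub A(1) by (rule finite_subset)
  show "card (places_at (Affine c)) \<le> 4" using card_mono[OF A(1) sub] A(2) by simp
  assume eq: "card (places_at (Affine c)) = 4"
  then have "card A = 4" using card_mono[OF A(1) sub] A(2) by simp
  then show "places_at (Affine c) \<subseteq> range point_place" using A(3) sub by blast
qed

text \<open>Four places at a finite value exhaust the degree, so all of them belong to rational
  points. Conversely, four rational points already reach the upper bound on the number of
  places.\<close>

lemma card_places_at_iff: "card (places_at t) = 4 \<longleftrightarrow> card (fibre t) = 4"
proof (cases t)
  case Infinity
  then show ?thesis by (simp add: places_at_Infinity card_point_place_fibre)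
next
  case (Affine c)
  note bound = places_at_Affine_bound[of c, folded Affine]
  have sub: "point_place ` fibre t \<subseteq> places_at t"
    using point_place_in_places_at_iff by blast
  show ?thesis
  proof
    assume "card (places_at t) = 4"
    with bound(3) have "places_at t \<subseteq> point_place ` fibre t"
      using point_place_in_places_at_iff by blast
    with sub have "places_at t = point_place ` fibre t" by blast
    then show "card (fibre t) = 4" using \<open>card (places_at t) = 4\<close> card_point_place_fibre[of t] by simp
  next
    assume "card (fibre t) = 4"
    then show "card (places_at t) = 4"
      using card_mono[OF bound(1) sub] bound(2) card_point_place_fibre[of t] by simp
  qed
qed

lemma card_T1_split_h: "card (T1_split h) = card {t. card (fibre t) = 4}"
  using card_T1_split[OF h_not_constant] card_places_at_iff
  by (simp add: ratfun_degree_h places_at_def)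

text \<open>
  Unless \<open>a\<close> is a pole, the left-hand side vanishes iff \<open>b\<close> is in the orbit of \<open>a\<close> under the homography
  \<open>x \<mapsto> - d\<^sup>2 / (2 (x - d))\<close> of order 4.
\<close>

lemma numer_denom_cross:
  "poly numer b * poly denom a - poly numer a * poly denom b =
    2 * (b - a) * (2 * (a - d) * b + d ^ 2) * ((2 * a - d) * b - d * (a - d)) * (2 * a * b - d * (2 * a - d))"
  unfolding poly_numer poly_denom by (simp add: algebra_simps power_numeral_reduce)

definition fixpoints :: "'a set" where
  "fixpoints = {a. 2 * a ^ 2 - 2 * d * a + d ^ 2 = 0}"

lemma fibre_eval_Affine:
  assumes a: "poly denom a \<noteq> 0"
  shows "fibre (ratfun_eval h (Affine a)) =
    Affine ` {a, - (d ^ 2) / (2 * (a - d)), d * (a - d) / (2 * a - d), d * (2 * a - d) / (2 * a)}"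
proof -
  have nz: "a \<noteq> 0" "a - d \<noteq> 0" "2 * a - d \<noteq> 0" using a by (auto simp: poly_denom)
  have iff: "Affine b \<in> fibre (ratfun_eval h (Affine a)) \<longleftrightarrow>
      b \<in> {a, - (d ^ 2) / (2 * (a - d)), d * (a - d) / (2 * a - d), d * (2 * a - d) / (2 * a)}" for b
  proof -
    \<comment> \<open>A pole b causes no exception: there \<open>denom\<close> vanishes and
      \<open>numer\<close> does not, so the difference is nonzero, as it must be because b is not in
      the fibre of a.\<close>
    have "Affine b \<in> fibre (ratfun_eval h (Affine a)) \<longleftrightarrow>
        poly numer b * poly denom a - poly numer a * poly denom b = 0"
      using a no_common_root[of b] by (auto simp: fibre_def eval_h_Affine frac_eq_eq)
    also have "\<dots> \<longleftrightarrow> b = a \<or> b * (2 * (a - d)) = - (d ^ 2) \<or> b * (2 * a - d) = d * (a - d)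
        \<or> b * (2 * a) = d * (2 * a - d)"
      unfolding numer_denom_cross by (simp add: eq_neg_iff_add_eq_0 mult_ac) blast
    also have "\<dots> \<longleftrightarrow> b \<in> {a, - (d ^ 2) / (2 * (a - d)), d * (a - d) / (2 * a - d), d * (2 * a - d) / (2 * a)}"
    proof -
      have "2 * (a - d) \<noteq> 0" "2 * a - d \<noteq> 0" "2 * a \<noteq> 0" using nz by auto
      then show ?thesis by (simp only: nonzero_eq_divide_eq insert_iff empty_iff simp_thms)
    qed
    finally show ?thesis .
  qed
  moreover have "Infinity \<notin> fibre (ratfun_eval h (Affine a))"
    using a by (simp add: fibre_def eval_h_Affine eval_h_Infinity)
  ultimately have "P \<in> fibre (ratfun_eval h (Affine a)) \<longleftrightarrow> P \<in>
    Affine ` {a, - (d ^ 2) / (2 * (a - d)), d * (a - d) / (2 * a - d), d * (2 * a - d) / (2 * a)}" for P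
    by (cases P) auto
  then show ?thesis by blast
qed

text \<open>All six differences between points of the orbit are the quadratic \<open>?q\<close> up
  to a nonzero factor. So the four points are either all equal or pairwise distinct.\<close>

lemma card_fibre_eval_Affine:
  assumes a: "poly denom a \<noteq> 0"
  shows "card (fibre (ratfun_eval h (Affine a))) = (if a \<in> fixpoints then 1 else 4)"
proof -
  have nz: "a \<noteq> 0" "a - d \<noteq> 0" "2 * a - d \<noteq> 0" using a by (auto simp: poly_denom)
  let ?q = "2 * a ^ 2 - 2 * d * a + d ^ 2"
  let ?g1 = "- (d ^ 2) / (2 * (a - d))" and ?g2 = "d * (a - d) / (2 * a - d)" and ?g3 = "d * (2 * a - d) / (2 * a)"
  have "a - ?g1 = ?q / (2 * (a - d))" "a - ?g2 = ?q / (2 * a - d)" "a - ?g3 = ?q / (2 * a)"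
    "?g1 - ?g2 = - (d * ?q) / (2 * (a - d) * (2 * a - d))" "?g1 - ?g3 = - (d * ?q) / (2 * a * (a - d))"
    "?g2 - ?g3 = - (d * ?q) / (2 * a * (2 * a - d))"
    using nz by (simp_all add: divide_simps) (simp_all add: algebra_simps power2_eq_square)
  note diffs = this
  have iff: "x = y \<longleftrightarrow> r = 0" if "x - y = r / c" "c \<noteq> 0" for x y r c :: 'a
    using that by (metis divide_eq_0_iff eq_iff_diff_eq_0)
  have eq: "a = ?g1 \<longleftrightarrow> ?q = 0" "a = ?g2 \<longleftrightarrow> ?q = 0" "a = ?g3 \<longleftrightarrow> ?q = 0"
    "?g1 = ?g2 \<longleftrightarrow> ?q = 0" "?g1 = ?g3 \<longleftrightarrow> ?q = 0" "?g2 = ?g3 \<longleftrightarrow> ?q = 0"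
    using diffs[THEN iff] nz by simp_all
  have "card (fibre (ratfun_eval h (Affine a))) = card {a, ?g1, ?g2, ?g3}"
    unfolding fibre_eval_Affine[OF a] by (intro card_image inj_onI) simp
  also have "\<dots> = (if a \<in> fixpoints then 1 else 4)"
  proof (cases "?q = 0")
    case True
    then have "?g1 = a" "?g2 = a" "?g3 = a"
      using eq(1-3)[THEN iffD2, symmetric] by simp_all
    then have "{a, ?g1, ?g2, ?g3} = {a}" by (simp only: insert_absorb2)
    then show ?thesis using True by (simp add: fixpoints_def)
  next
    case False
    then have "a \<noteq> ?g1" "a \<noteq> ?g2" "a \<noteq> ?g3" "?g1 \<noteq> ?g2" "?g1 \<noteq> ?g3" "?g2 \<noteq> ?g3" using eq by blast+
    then have "card {a, ?g1, ?g2, ?g3} = 4"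
      by (simp only: card_insert_if finite_insert finite.emptyI insert_iff empty_iff card.empty simp_thms if_False)
    then show ?thesis using False by (simp add: fixpoints_def)
  qed
  finally show ?thesis .
qed

text \<open>The quadratic takes the values d^2, d^2 and d^2 / 2 at the poles 0, d and d / 2.\<close>

lemma fixpoint_not_pole: "a \<in> fixpoints \<Longrightarrow> poly denom a \<noteq> 0"
  by (auto simp: fixpoints_def denom_root_iff power2_eq_square)

text \<open>The roots of the quadratic add up to d. They coincide only if d = 2 a; then the
  quadratic at a is 2 a^2, so a and d would be 0.\<close>

lemma fixpoints_cases:
  obtains "fixpoints = {}" | a where "fixpoints = {a, d - a}" "a \<noteq> d - a"
proof (cases "fixpoints = {}")
  case False
  then obtain a where a: "a \<in> fixpoints" by blast
  have "2 * (b - a) * (b - (d - a)) = (2 * b ^ 2 - 2 * d * b + d ^ 2) - (2 * a ^ 2 - 2 * d * a + d ^ 2)" for b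
    by (simp add: algebra_simps power2_eq_square)
  then have "b \<in> fixpoints \<longleftrightarrow> b = a \<or> b = d - a" for b
    using a unfolding fixpoints_def mem_Collect_eq
    by (metis (no_types, lifting) diff_0_right eq_iff_diff_eq_0 mult_eq_0_iff two_nonzero)
  then have "fixpoints = {a, d - a}" by blast
  moreover have "a \<noteq> d - a"
  proof
    assume "a = d - a"
    then have d: "d = 2 * a" by (simp add: eq_diff_eq)
    have "2 * a ^ 2 - 2 * d * a + d ^ 2 = 2 * a ^ 2"
      unfolding d by (simp add: algebra_simps power2_eq_square)
    then have "a = 0" using a by (simp add: fixpoints_def)
    then show False using d d_nonzero by simp
  qed
  ultimately show ?thesis using that by blast
qed

definition split_values :: "'a proj_line set" where
  "split_values = {t. card (fibre t) = 4}"

text \<open>Each point lies in the fibre of its own value. The poles together form the fibre of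
  \<open>Infinity\<close>, and for the other points the size of the fibre is known.\<close>

lemma Union_split_fibres: "(\<Union>t\<in>split_values. fibre t) = - (Affine ` fixpoints)"
proof -
  have "card (fibre (ratfun_eval h P)) = 4 \<longleftrightarrow> P \<notin> Affine ` fixpoints" for P
  proof (cases P)
    case Infinity
    then show ?thesis by (auto simp: eval_h_Infinity card_fibre_Infinity)
  next
    case (Affine a)
    show ?thesis
    proof (cases "poly denom a = 0")
      case True
      then have "a \<notin> fixpoints" using fixpoint_not_pole by blast
      then show ?thesis using True Affine by (auto simp: eval_h_Affine card_fibre_Infinity)
    next
      case False
      then show ?thesis using Affine by (auto simp: card_fibre_eval_Affine)
    qed
  qed
  then show ?thesis by (auto simp: split_values_def fibre_def)
qed

lemma disjoint_fibres: "t \<noteq> t' \<Longrightarrow> fibre t \<inter> fibre t' = {}"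
  by (auto simp: fibre_def)

lemma eval_h_fibre: "t \<in> split_values \<Longrightarrow> ratfun_eval h ` fibre t = {t}"
  unfolding split_values_def by (cases "fibre t = {}") (auto simp: fibre_def)

lemma Infinity_split: "Infinity \<in> split_values"
  by (simp add: split_values_def card_fibre_Infinity)

end

section \<open>Counting over a finite field\<close>

lemma UNIV_proj_line: "(UNIV :: 'a proj_line set) = insert Infinity (range Affine)"
  by (auto intro: proj_line.exhaust)

lemma finite_proj_line [simp]: "finite (A :: 'a::finite proj_line set)"
  by (rule finite_subset[OF subset_UNIV]) (simp add: UNIV_proj_line)

lemma card_proj_line: "card (UNIV :: 'a::finite proj_line set) = CARD('a) + 1"
proof -
  have "card (range (Affine :: 'a \<Rightarrow> _)) = CARD('a)" by (intro card_image injI) simp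
  moreover have "Infinity \<notin> range (Affine :: 'a \<Rightarrow> _)" by auto
  ultimately show ?thesis unfolding UNIV_proj_line by simp
qed

locale finite_quartic = quartic d for d :: "'a::{field,finite}"
begin

text \<open>The split fibres cut the q + 1 rational points, apart from the fixed ones, into disjoint
  sets of four.\<close>

lemma card_split_values: "4 * card split_values + card fixpoints = CARD('a) + 1"
proof -
  have "card (\<Union>t\<in>split_values. fibre t) = (\<Sum>t\<in>split_values. card (fibre t))"
    by (rule card_UN_disjoint) (use disjoint_fibres in auto)
  then have "card (- (Affine ` fixpoints)) = 4 * card split_values"
    unfolding Union_split_fibres by (simp add: split_values_def)
  moreover have "card (Affine ` fixpoints) = card fixpoints"
    by (intro card_image inj_onI) simp
  moreover have "card (Affine ` fixpoints) + card (- (Affine ` fixpoints)) = CARD('a) + 1"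
    unfolding card_proj_line[symmetric] by (subst card_Un_disjoint[symmetric]) auto
  ultimately show ?thesis by simp
qed

lemma card_fixpoints: "card fixpoints = 0 \<or> card fixpoints = 2"
  by (cases rule: fixpoints_cases) auto

lemma card_split_values_mod:
  "CARD('a) mod 4 = 3 \<Longrightarrow> card split_values = (CARD('a) + 1) div 4"
  "CARD('a) mod 4 = 1 \<Longrightarrow> card split_values = (CARD('a) - 1) div 4"
proof -
  define m where "m = CARD('a) div 4"
  have m: "CARD('a) = 4 * m + CARD('a) mod 4" by (simp add: m_def)
  show "card split_values = (CARD('a) + 1) div 4" if "CARD('a) mod 4 = 3"
  proof -
    have "CARD('a) = 4 * m + 3" using m that by simp
    with card_split_values card_fixpoints have "card split_values = m + 1" by arith
    with \<open>CARD('a) = 4 * m + 3\<close> show ?thesis by simp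
  qed
  show "card split_values = (CARD('a) - 1) div 4" if "CARD('a) mod 4 = 1"
  proof -
    have "CARD('a) = 4 * m + 1" using m that by simp
    with card_split_values card_fixpoints have "card split_values = m" by arith
    with \<open>CARD('a) = 4 * m + 1\<close> show ?thesis by simp
  qed
qed

lemma good_h: "good 3 (card split_values) h"
proof -
  have fin: "finite split_values" by simp
  obtain e where e: "bij_betw e {1..card split_values} split_values"
    using ex_bij_betw_nat_finite_1[OF fin] by blast
  show ?thesis
    unfolding good_def
  proof (intro conjI exI[of _ "\<lambda>i. fibre (e i)"] ballI)
    \<comment> \<open>The four poles always form a split fibre.\<close>
    show "1 \<le> card split_values"
      using Infinity_split fin by (auto simp: Suc_le_eq card_gt_0_iff)
    show "ratfun_degree h = 3 + 1" by (simp add: ratfun_degree_h)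
    show "disjoint_family_on (\<lambda>i. fibre (e i)) {1..card split_values}"
      unfolding disjoint_family_on_def
    proof (intro ballI impI)
      fix i j assume "i \<in> {1..card split_values}" "j \<in> {1..card split_values}" "i \<noteq> j"
      then have "e i \<noteq> e j" using inj_onD[OF bij_betw_imp_inj_on[OF e]] by blast
      then show "fibre (e i) \<inter> fibre (e j) = {}" by (rule disjoint_fibres)
    qed
    fix i assume "i \<in> {1..card split_values}"
    then have "e i \<in> split_values" using bij_betwE[OF e] by blast
    then show "card (fibre (e i)) = 3 + 1" "\<exists>t. ratfun_eval h ` fibre (e i) = {t}"
      using eval_h_fibre by (auto simp: split_values_def)
  qed
qed

end

subsection \<open>The Galois group\<close>

lemma ratfun_subst_pcompose: "ratfun_subst (pcompose v w) s = ratfun_subst v (ratfun_subst w s)"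
  by (induction v) (simp_all add: pcompose_pCons)

lemma transcendental_subst:
  assumes "transcendental s" "Polynomial.degree w > 0"
  shows "transcendental (ratfun_subst w s)"
  using assms pcompose_eq_0[of _ w]
  by (auto simp: transcendental_def simp flip: ratfun_subst_pcompose)

locale constant_hom =
  fixes \<sigma> :: "'a::field poly fract \<Rightarrow> 'a poly fract"
  assumes add: "\<sigma> (a + b) = \<sigma> a + \<sigma> b" and mult: "\<sigma> (a * b) = \<sigma> a * \<sigma> b"
    and const [simp]: "\<sigma> (ratfun_const c) = ratfun_const c"
begin

lemma zero_one [simp]: "\<sigma> 0 = 0" "\<sigma> 1 = 1"
  using const[of 0] const[of 1] by (simp_all del: const)

lemma numeral [simp]: "\<sigma> (numeral n) = numeral n"
  using const[of "numeral n"] by (simp del: const)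

lemma minus: "\<sigma> (- a) = - \<sigma> a"
  using add[of a "- a"] by (simp add: eq_neg_iff_add_eq_0 add.commute)

lemma diff: "\<sigma> (a - b) = \<sigma> a - \<sigma> b"
  using add[of a "- b"] by (simp add: minus)

lemma inverse: "\<sigma> (inverse a) = inverse (\<sigma> a)"
proof (cases "a = 0")
  case False
  then have "\<sigma> a * \<sigma> (inverse a) = 1" by (simp flip: mult)
  then show ?thesis by (rule inverse_unique[symmetric])
qed simp

lemma divide: "\<sigma> (a / b) = \<sigma> a / \<sigma> b"
  by (simp add: divide_inverse mult inverse)

lemma power: "\<sigma> (a ^ n) = \<sigma> a ^ n"
  by (induction n) (simp_all add: mult)

lemma subst: "\<sigma> (ratfun_subst u s) = ratfun_subst u (\<sigma> s)"
  by (induction u) (simp_all add: add mult)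

lemma fixes_subfield: "\<sigma> s = s \<Longrightarrow> z \<in> ratfun_subfield s \<Longrightarrow> \<sigma> z = z"
  by (elim ratfun_subfield_cases) (simp add: divide subst)

lemma ext:
  assumes "constant_hom \<tau>" "\<sigma> ratfun_X = \<tau> ratfun_X"
  shows "\<sigma> = \<tau>"
proof
  interpret \<tau>: constant_hom \<tau> by fact
  fix z
  show "\<sigma> z = \<tau> z"
    using assms(2) by (cases z) (simp add: Fract_ratfun_subst divide subst \<tau>.divide \<tau>.subst)
qed

end

lemma constant_hom_id: "constant_hom (\<lambda>z. z)"
  by unfold_locales simp_all

lemma constant_hom_comp: "constant_hom \<sigma> \<Longrightarrow> constant_hom \<tau> \<Longrightarrow> constant_hom (\<sigma> \<circ> \<tau>)"
  by (simp add: constant_hom_def)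

lemma automorphisms_over_iff:
  assumes "constants \<subseteq> K"
  shows "\<sigma> \<in> automorphisms_over K \<longleftrightarrow> constant_hom \<sigma> \<and> bij \<sigma> \<and> (\<forall>a\<in>K. \<sigma> a = a)"
proof -
  have "\<sigma> 1 = 1" if "\<forall>a\<in>K. \<sigma> a = a"
    using that assms by (metis ratfun_const_hom(2) rangeI subsetD)
  then show ?thesis
    using assms by (auto simp: automorphisms_over_def ring_iso_def ring_hom_def constant_hom_def)
qed

text \<open>Substitution of s for x. Lowest terms only serve to select a fraction for z; for
  transcendental s every fraction gives the same result.\<close>

definition ratfun_compose :: "'a::field poly fract \<Rightarrow> 'a poly fract \<Rightarrow> 'a poly fract" where
  "ratfun_compose s z =
    ratfun_subst (fst (lowest_terms z)) s / ratfun_subst (snd (lowest_terms z)) s"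

text \<open>Two fractions for the same function satisfy u g = f v. This identity survives the
  substitution, and transcendence of s keeps both denominators nonzero.\<close>

lemma ratfun_compose_quotient:
  assumes s: "transcendental s" and v: "v \<noteq> 0"
  shows "ratfun_compose s (ratfun_subst u ratfun_X / ratfun_subst v ratfun_X)
    = ratfun_subst u s / ratfun_subst v s"
proof -
  define z where "z = ratfun_subst u ratfun_X / ratfun_subst v ratfun_X"
  define f g where "f = fst (lowest_terms z)" "g = snd (lowest_terms z)"
  have "coprime f g \<and> lead_coeff g = 1 \<and> z = Fract f g"
    unfolding f_g_def lowest_terms_def by (rule theI'[OF lowest_terms_ex1])
  then have g: "g \<noteq> 0" and "Fract u v = Fract f g" by (auto simp: z_def Fract_ratfun_subst)
  then have "u * g = f * v" using v by (simp add: eq_fract)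
  then have "ratfun_subst u s * ratfun_subst g s = ratfun_subst f s * ratfun_subst v s"
    by (metis ratfun_subst_mult)
  moreover have "ratfun_subst g s \<noteq> 0" "ratfun_subst v s \<noteq> 0"
    using s g v by (auto simp: transcendental_def)
  ultimately show ?thesis
    unfolding z_def[symmetric] ratfun_compose_def f_g_def[symmetric] by (simp add: frac_eq_eq)
qed

lemma constant_hom_compose:
  assumes s: "transcendental s"
  shows "constant_hom (ratfun_compose s)" and "ratfun_compose s ratfun_X = s"
proof -
  have q: "\<exists>u v. v \<noteq> 0 \<and> z = ratfun_subst u ratfun_X / ratfun_subst v ratfun_X" for z :: "'a poly fract"
    by (cases z) (auto simp: Fract_ratfun_subst)
  have nz: "ratfun_subst v s \<noteq> 0" "ratfun_subst v ratfun_X \<noteq> 0" if "v \<noteq> 0" for v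
    using s transcendental_X that by (auto simp: transcendental_def)
  note simps = ratfun_compose_quotient[OF s]
  show "constant_hom (ratfun_compose s)"
  proof
    fix a b :: "'a poly fract"
    obtain u v u' v' where ab: "v \<noteq> 0" "a = ratfun_subst u ratfun_X / ratfun_subst v ratfun_X"
      "v' \<noteq> 0" "b = ratfun_subst u' ratfun_X / ratfun_subst v' ratfun_X"
      using q[of a] q[of b] by blast
    have "a + b = ratfun_subst (u * v' + u' * v) ratfun_X / ratfun_subst (v * v') ratfun_X"
      using ab nz by (simp add: add_frac_eq)
    then have "ratfun_compose s (a + b) = ratfun_subst (u * v' + u' * v) s / ratfun_subst (v * v') s"
      using ab by (simp only: simps mult_eq_0_iff simp_thms)
    then show "ratfun_compose s (a + b) = ratfun_compose s a + ratfun_compose s b"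
      using ab nz by (simp add: simps add_frac_eq)
    have "a * b = ratfun_subst (u * u') ratfun_X / ratfun_subst (v * v') ratfun_X"
      using ab by simp
    then have "ratfun_compose s (a * b) = ratfun_subst (u * u') s / ratfun_subst (v * v') s"
      using ab by (simp only: simps mult_eq_0_iff simp_thms)
    then show "ratfun_compose s (a * b) = ratfun_compose s a * ratfun_compose s b"
      using ab by (simp add: simps)
    show "ratfun_compose s (ratfun_const c) = ratfun_const c" for c
      using simps[of 1 "[:c:]"] by simp
  qed
  show "ratfun_compose s ratfun_X = s"
    using simps[of 1 "[:0, 1:]"] by simp
qed

section \<open>The conjugates of x and the automorphism of order 4\<close>

context quartic
begin

abbreviation \<xi> where "\<xi> \<equiv> ratfun_X :: 'a poly fract"
abbreviation \<delta> where "\<delta> \<equiv> ratfun_const d"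
abbreviation K where "K \<equiv> ratfun_subfield h"

text \<open>\<open>\<xi>1\<close>, \<open>\<xi>2\<close>, \<open>\<xi>3\<close> are g(x), g^2(x),
  g^3(x): the orbit formulas for a point, read at the generic point x.\<close>

definition \<xi>1 where "\<xi>1 = - (\<delta> ^ 2) / (2 * (\<xi> - \<delta>))"
definition \<xi>2 where "\<xi>2 = \<delta> * (\<xi> - \<delta>) / (2 * \<xi> - \<delta>)"
definition \<xi>3 where "\<xi>3 = \<delta> * (2 * \<xi> - \<delta>) / (2 * \<xi>)"

lemma X_nonzero: "\<xi> - \<delta> \<noteq> 0" "2 * \<xi> - \<delta> \<noteq> 0" "2 * \<xi> ^ 2 - 2 * \<delta> * \<xi> + \<delta> ^ 2 \<noteq> 0"
proof -
  have *: "u \<noteq> 0 \<Longrightarrow> ratfun_subst u \<xi> \<noteq> 0" for u :: "'a poly"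
    using transcendental_X by (auto simp: transcendental_def)
  show "\<xi> - \<delta> \<noteq> 0" "2 * \<xi> - \<delta> \<noteq> 0"
    using *[of "[:- d, 1:]"] *[of "[:- d, 2:]"] by (simp_all add: mult.commute)
  show "2 * \<xi> ^ 2 - 2 * \<delta> * \<xi> + \<delta> ^ 2 \<noteq> 0"
    using *[of "[:d ^ 2, - 2 * d, 2:]"] by (simp add: algebra_simps power2_eq_square)
qed

lemma subst_numer_denom_cross:
  "ratfun_subst numer b * ratfun_subst denom a - ratfun_subst numer a * ratfun_subst denom b =
    2 * (b - a) * (2 * (a - \<delta>) * b + \<delta> ^ 2) * ((2 * a - \<delta>) * b - \<delta> * (a - \<delta>)) * (2 * a * b - \<delta> * (2 * a - \<delta>))"
  unfolding subst_numer subst_denom by (simp add: algebra_simps power_numeral_reduce)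

text \<open>The cross difference of \<open>numer\<close> and \<open>denom\<close> at y and x factors
  as it does for points, with roots the orbit of x. So the orbit is the set of roots in F(x) of a
  quartic equation over K.\<close>

lemma conjugate_iff:
  "ratfun_subst numer y = h * ratfun_subst denom y \<longleftrightarrow> y \<in> {\<xi>, \<xi>1, \<xi>2, \<xi>3}"
proof -
  have "ratfun_subst numer y = h * ratfun_subst denom y \<longleftrightarrow>
      ratfun_subst numer y * ratfun_subst denom \<xi> - ratfun_subst numer \<xi> * ratfun_subst denom y = 0"
    by (simp add: h_def field_simps)
  also have "\<dots> \<longleftrightarrow> y = \<xi> \<or> y * (2 * (\<xi> - \<delta>)) = - (\<delta> ^ 2) \<or> y * (2 * \<xi> - \<delta>) = \<delta> * (\<xi> - \<delta>)
      \<or> y * (2 * \<xi>) = \<delta> * (2 * \<xi> - \<delta>)"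
    unfolding subst_numer_denom_cross by (simp add: eq_neg_iff_add_eq_0 mult_ac) blast
  also have "\<dots> \<longleftrightarrow> y \<in> {\<xi>, \<xi>1, \<xi>2, \<xi>3}"
  proof -
    have "2 * (\<xi> - \<delta>) \<noteq> 0" "2 * \<xi> - \<delta> \<noteq> 0" "2 * \<xi> \<noteq> 0" using X_nonzero by auto
    then show ?thesis
      unfolding \<xi>1_def \<xi>2_def \<xi>3_def by (simp only: nonzero_eq_divide_eq insert_iff empty_iff simp_thms)
  qed
  finally show ?thesis .
qed

lemma conjugates_distinct: "card {\<xi>, \<xi>1, \<xi>2, \<xi>3} = 4"
proof -
  let ?q = "2 * \<xi> ^ 2 - 2 * \<delta> * \<xi> + \<delta> ^ 2"
  have iff: "x \<noteq> y" if "x - y = r / c" "c \<noteq> 0" "r \<noteq> 0" for x y r c :: "'a poly fract"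
    using that by auto
  have "\<xi> - \<xi>1 = ?q / (2 * (\<xi> - \<delta>))" "\<xi> - \<xi>2 = ?q / (2 * \<xi> - \<delta>)" "\<xi> - \<xi>3 = ?q / (2 * \<xi>)"
    "\<xi>1 - \<xi>2 = - (\<delta> * ?q) / (2 * (\<xi> - \<delta>) * (2 * \<xi> - \<delta>))" "\<xi>1 - \<xi>3 = - (\<delta> * ?q) / (2 * \<xi> * (\<xi> - \<delta>))"
    "\<xi>2 - \<xi>3 = - (\<delta> * ?q) / (2 * \<xi> * (2 * \<xi> - \<delta>))"
    using X_nonzero unfolding \<xi>1_def \<xi>2_def \<xi>3_def
    by (simp_all add: divide_simps) (simp_all add: algebra_simps power2_eq_square)
  from this[THEN iff] have "\<xi> \<noteq> \<xi>1" "\<xi> \<noteq> \<xi>2" "\<xi> \<noteq> \<xi>3" "\<xi>1 \<noteq> \<xi>2" "\<xi>1 \<noteq> \<xi>3" "\<xi>2 \<noteq> \<xi>3"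
    using X_nonzero by simp_all
  then show ?thesis
    by (simp only: card_insert_if finite_insert finite.emptyI insert_iff empty_iff card.empty simp_thms if_False)
qed

definition rot :: "'a poly fract \<Rightarrow> 'a poly fract" where
  "rot = ratfun_compose \<xi>1"

text \<open>Affine maps and inversion preserve transcendence, and g is composed of these.\<close>

lemma transcendental_X1: "transcendental \<xi>1"
proof -
  have "transcendental (ratfun_subst [:0, - (d ^ 2):] (inverse (ratfun_subst [:- 2 * d, 2:] \<xi>)))"
    by (intro transcendental_subst transcendental_inverse transcendental_X) simp_all
  also have "ratfun_subst [:0, - (d ^ 2):] (inverse (ratfun_subst [:- 2 * d, 2:] \<xi>)) = \<xi>1"
    by (simp add: \<xi>1_def divide_inverse algebra_simps)
  finally show ?thesis .
qed

sublocale rot: constant_hom rot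
  unfolding rot_def by (rule constant_hom_compose[OF transcendental_X1])

lemma rot_X: "rot \<xi> = \<xi>1"
  unfolding rot_def by (rule constant_hom_compose[OF transcendental_X1])

lemma rot_X1: "rot \<xi>1 = \<xi>2"
proof -
  have "2 * (\<xi>1 - \<delta>) = - \<delta> * (2 * \<xi> - \<delta>) / (\<xi> - \<delta>)"
    using X_nonzero unfolding \<xi>1_def by (simp add: divide_simps) (simp add: algebra_simps power2_eq_square)
  moreover have "rot \<xi>1 = - (\<delta> ^ 2) / (2 * (\<xi>1 - \<delta>))"
    by (simp add: \<xi>1_def rot.divide rot.minus rot.mult rot.diff rot.power rot_X[unfolded \<xi>1_def])
  ultimately have "rot \<xi>1 = - (\<delta> ^ 2) / (- \<delta> * (2 * \<xi> - \<delta>) / (\<xi> - \<delta>))" by simp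
  then show ?thesis
    using X_nonzero unfolding \<xi>2_def by (simp add: power2_eq_square)
qed

lemma rot_X2: "rot \<xi>2 = \<xi>3"
proof -
  have "2 * \<xi>1 - \<delta> = - (\<delta> * \<xi>) / (\<xi> - \<delta>)" "\<xi>1 - \<delta> = - \<delta> * (2 * \<xi> - \<delta>) / (2 * (\<xi> - \<delta>))"
    using X_nonzero unfolding \<xi>1_def by (simp_all add: divide_simps) (simp_all add: algebra_simps power2_eq_square)
  moreover have "rot \<xi>2 = \<delta> * (\<xi>1 - \<delta>) / (2 * \<xi>1 - \<delta>)"
    by (simp add: \<xi>2_def rot.divide rot.mult rot.diff rot_X)
  ultimately have "rot \<xi>2 = \<delta> * (- \<delta> * (2 * \<xi> - \<delta>) / (2 * (\<xi> - \<delta>))) / (- (\<delta> * \<xi>) / (\<xi> - \<delta>))" by simp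
  then show ?thesis
    using X_nonzero unfolding \<xi>3_def by (simp del: right_diff_distrib_numeral)
qed

lemma rot_X3: "rot \<xi>3 = \<xi>"
proof -
  have "2 * \<xi>1 - \<delta> = - (\<delta> * \<xi>) / (\<xi> - \<delta>)"
    using X_nonzero unfolding \<xi>1_def by (simp_all add: divide_simps) (simp_all add: algebra_simps power2_eq_square)
  moreover have "rot \<xi>3 = \<delta> * (2 * \<xi>1 - \<delta>) / (2 * \<xi>1)"
    by (simp add: \<xi>3_def rot.divide rot.mult rot.diff rot_X)
  ultimately have "rot \<xi>3 = \<delta> * (- (\<delta> * \<xi>) / (\<xi> - \<delta>)) / (2 * \<xi>1)" by simp
  then show ?thesis
    using X_nonzero unfolding \<xi>1_def
    by (simp add: power2_eq_square del: right_diff_distrib_numeral left_diff_distrib_numeral)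
qed

lemma rot_h: "rot h = h"
proof -
  have "ratfun_subst numer \<xi>1 = h * ratfun_subst denom \<xi>1"
    by (simp add: conjugate_iff)
  moreover have "ratfun_subst denom \<xi>1 \<noteq> 0"
    using transcendental_X1 degree_denom by (auto simp: transcendental_def)
  ultimately show ?thesis by (simp add: h_def rot.divide rot.subst rot_X)
qed

lemma rot_fixes_K: "z \<in> K \<Longrightarrow> rot z = z"
  using rot.fixes_subfield[OF rot_h] .

lemma constant_hom_rot_power: "constant_hom (rot ^^ n)"
proof (induction n)
  case 0
  show ?case using constant_hom_id by (simp add: id_def)
next
  case (Suc n)
  then show ?case
    unfolding funpow.simps by (rule constant_hom_comp[OF rot.constant_hom_axioms])
qed

lemma rot_power_4: "rot ^^ 4 = id"
proof -
  interpret r: constant_hom "rot ^^ 4" by (rule constant_hom_rot_power)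
  show ?thesis
    unfolding id_def by (rule r.ext[OF constant_hom_id]) (simp add: numeral_eq_Suc rot_X rot_X1 rot_X2 rot_X3)
qed

lemma rot_power_automorphism: "rot ^^ n \<in> automorphisms_over K"
proof -
  have "rot \<circ> (rot ^^ 3) = id" "(rot ^^ 3) \<circ> rot = id"
    using rot_power_4 by (simp_all add: numeral_eq_Suc fun_eq_iff)
  then have "bij rot" by (rule o_bij[rotated])
  moreover have "(rot ^^ n) z = z" if "z \<in> K" for z
    using rot_fixes_K[OF that] by (induction n) simp_all
  ultimately show ?thesis
    by (subst automorphisms_over_iff) (auto simp: constant_hom_rot_power bij_fn)
qed

text \<open>An automorphism over K is determined by the image of x, which must again satisfy the
  quartic equation of x over K. This allows four images, and the powers of \<open>rot\<close> attain
  them all.\<close>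

lemma card_automorphisms: "card (automorphisms_over K) = 4"
proof -
  have "bij_betw (\<lambda>\<sigma>. \<sigma> \<xi>) (automorphisms_over K) {\<xi>, \<xi>1, \<xi>2, \<xi>3}"
  proof (rule bij_betw_imageI)
    have iff: "\<sigma> \<in> automorphisms_over K \<longleftrightarrow> constant_hom \<sigma> \<and> bij \<sigma> \<and> (\<forall>a\<in>K. \<sigma> a = a)" for \<sigma>
      by (rule automorphisms_over_iff) auto
    show "inj_on (\<lambda>\<sigma>. \<sigma> \<xi>) (automorphisms_over K)"
      by (rule inj_onI) (metis iff constant_hom.ext)
    show "(\<lambda>\<sigma>. \<sigma> \<xi>) ` automorphisms_over K = {\<xi>, \<xi>1, \<xi>2, \<xi>3}"
    proof
      show "(\<lambda>\<sigma>. \<sigma> \<xi>) ` automorphisms_over K \<subseteq> {\<xi>, \<xi>1, \<xi>2, \<xi>3}"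
      proof
        fix y assume "y \<in> (\<lambda>\<sigma>. \<sigma> \<xi>) ` automorphisms_over K"
        then obtain \<sigma> where \<sigma>: "constant_hom \<sigma>" "\<forall>a\<in>K. \<sigma> a = a" "y = \<sigma> \<xi>"
          using iff by blast
        interpret constant_hom \<sigma> by fact
        have "ratfun_subst numer \<xi> = h * ratfun_subst denom \<xi>" by (simp add: h_def)
        then have "\<sigma> (ratfun_subst numer \<xi>) = \<sigma> (h * ratfun_subst denom \<xi>)" by simp
        then have "ratfun_subst numer y = h * ratfun_subst denom y"
          using \<sigma> by (simp add: subst mult)
        then show "y \<in> {\<xi>, \<xi>1, \<xi>2, \<xi>3}" by (simp add: conjugate_iff)
      qed
      have "(rot ^^ n) \<xi> \<in> (\<lambda>\<sigma>. \<sigma> \<xi>) ` automorphisms_over K" for n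
        by (intro image_eqI[OF refl] rot_power_automorphism)
      from this[of 0] this[of 1] this[of 2] this[of 3]
      show "{\<xi>, \<xi>1, \<xi>2, \<xi>3} \<subseteq> (\<lambda>\<sigma>. \<sigma> \<xi>) ` automorphisms_over K"
        by (simp add: numeral_eq_Suc rot_X rot_X1 rot_X2)
    qed
  qed
  then show ?thesis using bij_betw_same_card conjugates_distinct by metis
qed

section \<open>The power basis of F(x) over K\<close>

lemma power_basis_independent:
  assumes c: "c0 \<in> K" "c1 \<in> K" "c2 \<in> K" "c3 \<in> K"
    and zero: "c0 + c1 * \<xi> + c2 * \<xi> ^ 2 + c3 * \<xi> ^ 3 = 0"
  shows "c0 = 0 \<and> c1 = 0 \<and> c2 = 0 \<and> c3 = 0"
proof -
  define p where "p = [:c0, c1, c2, c3:]"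
  have p: "poly p y = c0 + c1 * y + c2 * y ^ 2 + c3 * y ^ 3" for y
    by (simp add: p_def algebra_simps power2_eq_square power3_eq_cube)
  \<comment> \<open>\<open>rot\<close> fixes the coefficients, so it carries roots of p to roots. A
    nonzero p of degree at most 3 would have all four conjugates of x as roots.\<close>
  have step: "poly p (rot y) = 0" if "poly p y = 0" for y
  proof -
    have "poly p (rot y) = rot (poly p y)"
      using c by (simp add: p rot.add rot.mult rot.power rot_fixes_K)
    then show ?thesis using that by simp
  qed
  have "poly p \<xi> = 0" using zero by (simp add: p)
  then have roots: "{\<xi>, \<xi>1, \<xi>2, \<xi>3} \<subseteq> {y. poly p y = 0}"
    using step[of \<xi>] step[of \<xi>1] step[of \<xi>2] by (simp add: rot_X rot_X1 rot_X2)
  have "p = 0"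
  proof (rule ccontr)
    assume "p \<noteq> 0"
    then have "card {\<xi>, \<xi>1, \<xi>2, \<xi>3} \<le> Polynomial.degree p"
      using card_mono[OF poly_roots_finite roots] card_poly_roots_bound[of p] by simp
    moreover have "Polynomial.degree p \<le> 3" by (simp add: p_def)
    ultimately show False using conjugates_distinct by simp
  qed
  then show ?thesis by (simp add: p_def)
qed

definition power_span :: "'a poly fract set" where
  "power_span = {c0 + c1 * \<xi> + c2 * \<xi> ^ 2 + c3 * \<xi> ^ 3 | c0 c1 c2 c3. c0 \<in> K \<and> c1 \<in> K \<and> c2 \<in> K \<and> c3 \<in> K}"

lemma power_spanI:
  "c0 \<in> K \<Longrightarrow> c1 \<in> K \<Longrightarrow> c2 \<in> K \<Longrightarrow> c3 \<in> K \<Longrightarrow>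
    z = c0 + c1 * \<xi> + c2 * \<xi> ^ 2 + c3 * \<xi> ^ 3 \<Longrightarrow> z \<in> power_span"
  unfolding power_span_def by blast

lemma power_spanE:
  assumes "z \<in> power_span"
  obtains c0 c1 c2 c3 where "c0 \<in> K" "c1 \<in> K" "c2 \<in> K" "c3 \<in> K"
    "z = c0 + c1 * \<xi> + c2 * \<xi> ^ 2 + c3 * \<xi> ^ 3"
  using assms unfolding power_span_def by blast

lemma power_span_add: "z \<in> power_span \<Longrightarrow> w \<in> power_span \<Longrightarrow> z + w \<in> power_span"
proof -
  assume "z \<in> power_span" "w \<in> power_span"
  then obtain c0 c1 c2 c3 b0 b1 b2 b3 where "c0 \<in> K" "c1 \<in> K" "c2 \<in> K" "c3 \<in> K"
    "z = c0 + c1 * \<xi> + c2 * \<xi> ^ 2 + c3 * \<xi> ^ 3" "b0 \<in> K" "b1 \<in> K" "b2 \<in> K" "b3 \<in> K"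
    "w = b0 + b1 * \<xi> + b2 * \<xi> ^ 2 + b3 * \<xi> ^ 3"
    by (elim power_spanE) blast
  then show "z + w \<in> power_span"
    by (intro power_spanI[of "c0 + b0" "c1 + b1" "c2 + b2" "c3 + b3"] ratfun_subfield_closed)
       (simp_all add: algebra_simps)
qed

lemma power_span_scale: "c \<in> K \<Longrightarrow> z \<in> power_span \<Longrightarrow> c * z \<in> power_span"
proof -
  assume "c \<in> K" "z \<in> power_span"
  then obtain c0 c1 c2 c3 where "c0 \<in> K" "c1 \<in> K" "c2 \<in> K" "c3 \<in> K"
    "z = c0 + c1 * \<xi> + c2 * \<xi> ^ 2 + c3 * \<xi> ^ 3" by (elim power_spanE)
  then show "c * z \<in> power_span"
    using \<open>c \<in> K\<close> by (intro power_spanI[of "c * c0" "c * c1" "c * c2" "c * c3"] ratfun_subfield_closed)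
       (simp_all add: algebra_simps)
qed

text \<open>The relation \<open>numer\<close> = h \<open>denom\<close> at x, solved for its leading
  term. It reduces x^4 to lower powers with coefficients in K.\<close>

lemma \<xi>_power_4:
  "4 * \<xi> ^ 4 = \<delta> ^ 4 + (2 * \<delta> ^ 2 * h - 8 * \<delta> ^ 3) * \<xi> + (12 * \<delta> ^ 2 - 6 * \<delta> * h) * \<xi> ^ 2 + 4 * h * \<xi> ^ 3"
proof -
  have "ratfun_subst numer \<xi> = h * ratfun_subst denom \<xi>" by (simp add: h_def)
  then show ?thesis
    unfolding subst_numer subst_denom
    by (simp add: algebra_simps power2_eq_square power3_eq_cube)
qed

lemma K_numeral [simp]: "numeral n \<in> K" and K_power: "c \<in> K \<Longrightarrow> c ^ m \<in> K"
proof -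
  show "numeral n \<in> K" using ratfun_const_in_subfield[of "numeral n"] by simp
  show "c \<in> K \<Longrightarrow> c ^ m \<in> K" by (induction m) (auto intro: ratfun_subfield_closed)
qed

lemma power_span_X: "z \<in> power_span \<Longrightarrow> \<xi> * z \<in> power_span"
proof -
  assume "z \<in> power_span"
  then obtain c0 c1 c2 c3 where c: "c0 \<in> K" "c1 \<in> K" "c2 \<in> K" "c3 \<in> K"
    and z: "z = c0 + c1 * \<xi> + c2 * \<xi> ^ 2 + c3 * \<xi> ^ 3" by (elim power_spanE)
  have "\<xi> * z = c0 * \<xi> + c1 * \<xi> ^ 2 + c2 * \<xi> ^ 3 + c3 / 4 * (4 * \<xi> ^ 4)"
    by (simp add: z algebra_simps power2_eq_square power3_eq_cube power4_eq_xxxx)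
  also have "\<dots> = c3 / 4 * \<delta> ^ 4 + (c0 + c3 / 4 * (2 * \<delta> ^ 2 * h - 8 * \<delta> ^ 3)) * \<xi>
      + (c1 + c3 / 4 * (12 * \<delta> ^ 2 - 6 * \<delta> * h)) * \<xi> ^ 2 + (c2 + c3 / 4 * (4 * h)) * \<xi> ^ 3"
    unfolding \<xi>_power_4 by (simp only: distrib_left distrib_right mult.assoc add_ac)
  finally show "\<xi> * z \<in> power_span"
    using c by (intro power_spanI) (auto intro!: ratfun_subfield_closed K_power)
qed

lemma power_span_subst: "z \<in> power_span \<Longrightarrow> ratfun_subst u \<xi> * z \<in> power_span"
proof (induction u)
  case 0
  then show ?case using power_span_scale[of 0 z] by (simp add: ratfun_subfield_closed)
next
  case (pCons a u)
  then have "ratfun_const a * z + \<xi> * (ratfun_subst u \<xi> * z) \<in> power_span"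
    using power_span_add[OF power_span_scale[of "ratfun_const a" z] power_span_X[of "ratfun_subst u \<xi> * z"]]
    by simp
  then show ?case by (simp add: algebra_simps)
qed

lemma one_in_power_span: "1 \<in> power_span"
  by (intro power_spanI[of 1 0 0 0]) (simp_all add: ratfun_subfield_closed)

interpretation E: field "ring_of_type_algebra :: 'a poly fract ring"
  by (rule field_type_algebra)

text \<open>For v = 1 this is the power basis. General v is needed for the inverse of a polynomial
  v(x).\<close>

abbreviation scaled_powers :: "'a poly fract \<Rightarrow> 'a poly fract list" where
  "scaled_powers v \<equiv> [v, v * \<xi>, v * \<xi> ^ 2, v * \<xi> ^ 3]"

lemma Span_scaled_powers: "E.Span K (scaled_powers v) = (\<lambda>m. v * m) ` power_span"
proof -
  have "z \<in> E.Span K (scaled_powers v) \<longleftrightarrow> z \<in> (\<lambda>m. v * m) ` power_span" for z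
  proof -
    have "z \<in> E.Span K (scaled_powers v) \<longleftrightarrow>
        (\<exists>Ks. set Ks \<subseteq> K \<and> length Ks = 4 \<and> z = E.combine Ks (scaled_powers v))"
      by (subst E.Span_mem_iff_length_version[OF subfield_ratfun_subfield]) (simp_all add: numeral_eq_Suc)
    also have "\<dots> \<longleftrightarrow> (\<exists>c0 c1 c2 c3. c0 \<in> K \<and> c1 \<in> K \<and> c2 \<in> K \<and> c3 \<in> K
        \<and> z = E.combine [c0, c1, c2, c3] (scaled_powers v))"
    proof
      assume "\<exists>Ks. set Ks \<subseteq> K \<and> length Ks = 4 \<and> z = E.combine Ks (scaled_powers v)"
      then obtain Ks where Ks: "set Ks \<subseteq> K" "length Ks = 4" "z = E.combine Ks (scaled_powers v)"
        by blast
      then obtain c0 c1 c2 c3 where "Ks = [c0, c1, c2, c3]"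
        by (auto simp: numeral_eq_Suc length_Suc_conv)
      with Ks show "\<exists>c0 c1 c2 c3. c0 \<in> K \<and> c1 \<in> K \<and> c2 \<in> K \<and> c3 \<in> K
          \<and> z = E.combine [c0, c1, c2, c3] (scaled_powers v)"
        by (simp only: list.set insert_subset) blast
    next
      assume "\<exists>c0 c1 c2 c3. c0 \<in> K \<and> c1 \<in> K \<and> c2 \<in> K \<and> c3 \<in> K
          \<and> z = E.combine [c0, c1, c2, c3] (scaled_powers v)"
      then obtain c0 c1 c2 c3 where "set [c0, c1, c2, c3] \<subseteq> K"
        "z = E.combine [c0, c1, c2, c3] (scaled_powers v)" by (simp only: list.set) blast
      moreover have "length [c0, c1, c2, c3] = 4" by simp
      ultimately show "\<exists>Ks. set Ks \<subseteq> K \<and> length Ks = 4 \<and> z = E.combine Ks (scaled_powers v)"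
        by blast
    qed
    also have "\<dots> \<longleftrightarrow> z \<in> (\<lambda>m. v * m) ` power_span"
    proof -
      have "E.combine [c0, c1, c2, c3] (scaled_powers v) = v * (c0 + c1 * \<xi> + c2 * \<xi> ^ 2 + c3 * \<xi> ^ 3)"
        for c0 c1 c2 c3 by (simp add: algebra_simps)
      note combine = this
      show ?thesis unfolding power_span_def image_def combine by blast
    qed
    finally show ?thesis .
  qed
  then show ?thesis by blast
qed

lemma scaled_powers_independent:
  assumes v: "v \<noteq> 0"
  shows "E.independent K (scaled_powers v)"
proof (rule E.trivial_combine_imp_independent[OF subfield_ratfun_subfield])
  show "set (scaled_powers v) \<subseteq> carrier ring_of_type_algebra" by simp
  fix Ks assume Ks: "set Ks \<subseteq> K" "E.combine Ks (scaled_powers v) = \<zero>\<^bsub>ring_of_type_algebra\<^esub>"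
  \<comment> \<open>The coefficient list may have any length. \<open>E.combine\<close> stops at the
    end of the shorter list, so missing coefficients count as 0 and those beyond the fourth are
    ignored.\<close>
  define c where "c i = (if i < length Ks then Ks ! i else 0)" for i
  have cK: "c i \<in> K" for i
    using Ks(1) by (auto simp: c_def ratfun_subfield_closed)
  have "E.combine Ks (scaled_powers v) = v * (c 0 + c 1 * \<xi> + c 2 * \<xi> ^ 2 + c 3 * \<xi> ^ 3)"
  proof -
    consider "Ks = []" | a where "Ks = [a]" | a b where "Ks = [a, b]" | a b e where "Ks = [a, b, e]"
      | a b e f Ls where "Ks = a # b # e # f # Ls"
      by (cases Ks; cases "tl Ks"; cases "tl (tl Ks)"; cases "tl (tl (tl Ks))") auto
    then show ?thesis by cases (simp_all add: c_def algebra_simps numeral_eq_Suc)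
  qed
  then have "c 0 + c 1 * \<xi> + c 2 * \<xi> ^ 2 + c 3 * \<xi> ^ 3 = 0" using Ks v by simp
  from power_basis_independent[OF cK cK cK cK this]
  have c0: "c i = 0" if "i < 4" for i
    using that by (auto simp: numeral_eq_Suc less_Suc_eq)
  show "set (take (length (scaled_powers v)) Ks) \<subseteq> {\<zero>\<^bsub>ring_of_type_algebra\<^esub>}"
  proof -
    have "Ks ! i = 0" if "i < length Ks" "i < Suc (Suc (Suc (Suc 0)))" for i
      using c0[of i] that by (simp add: c_def numeral_eq_Suc)
    then show ?thesis by (auto simp: in_set_conv_nth)
  qed
qed

lemma dimension_power_span: "E.dimension 4 K power_span"
  using E.dimensionI[OF subfield_ratfun_subfield scaled_powers_independent[of 1] Span_scaled_powers]
  by (simp add: numeral_eq_Suc)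

text \<open>
  Multiplication by \<open>v(x)\<close> maps the power basis of the \<open>K\<close>-space \<open>K[x]\<close> to another basis,
  so 1 is a multiple of \<open>v(x)\<close> in \<open>K[x]\<close>.
\<close>

lemma power_span_UNIV: "power_span = UNIV"
proof -
  have "z \<in> power_span" for z
  proof (cases z)
    case (Fract u v)
    define w where "w = ratfun_subst v \<xi>"
    have w: "w \<noteq> 0" using Fract transcendental_X by (auto simp: w_def transcendental_def)
    have mem: "w * m \<in> power_span" if "m \<in> power_span" for m
      unfolding w_def using that by (rule power_span_subst)
    have "\<xi> ^ i \<in> power_span" for i
      by (induction i) (auto intro: one_in_power_span power_span_X)
    from this[of 1] this have "set (scaled_powers w) \<subseteq> power_span"
      using mem[of 1] one_in_power_span mem by simp
    then have "E.Span K (scaled_powers w) = power_span"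
      using E.independent_length_eq_dimension[OF subfield_ratfun_subfield dimension_power_span
          scaled_powers_independent[OF w]] by simp
    then obtain m where m: "m \<in> power_span" "1 = w * m"
      using one_in_power_span unfolding Span_scaled_powers by blast
    then have "inverse w \<in> power_span" using inverse_unique[of w m] by simp
    then have "ratfun_subst u \<xi> * inverse w \<in> power_span" by (rule power_span_subst)
    then show ?thesis using Fract by (simp add: Fract_ratfun_subst w_def divide_inverse)
  qed
  then show ?thesis by blast
qed

lemma galois: "galois_over K"
proof -
  have "E.dim K UNIV = 4"
    using E.dimI[OF subfield_ratfun_subfield dimension_power_span]
    by (simp add: over_def power_span_UNIV)
  moreover have "E.finite_dimension K UNIV"
    using E.finite_dimensionI[OF dimension_power_span] by (simp add: power_span_UNIV)
  ultimately show ?thesis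
    by (simp add: galois_over_def subfield_ratfun_subfield card_automorphisms)
qed

lemma h_eq:
  "h = (4 * \<xi> ^ 4 - 12 * \<delta> ^ 2 * \<xi> ^ 2 + 8 * \<delta> ^ 3 * \<xi> - \<delta> ^ 4) / (2 * \<xi> * (\<xi> - \<delta>) * (2 * \<xi> - \<delta>))"
  by (simp only: h_def subst_numer subst_denom)

end

theorem proposition5p6:
  fixes q :: nat and d :: "'a::{field,finite}" and h :: "'a poly fract"
  assumes "CARD('a) = q" and "odd q" and "d \<noteq> 0"
    and "h = (let x = ratfun_X; d' = ratfun_const d in
               (4 * x ^ 4 - 12 * d' ^ 2 * x ^ 2 + 8 * d' ^ 3 * x - d' ^ 4) /
               (2 * x * (x - d') * (2 * x - d')))"
  shows "galois_over (ratfun_subfield h) \<and>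
    (q mod 4 = 3 \<longrightarrow>
      card (T1_split h) = (q + 1) div 4 \<and> good 3 ((q + 1) div 4) h) \<and>
    (q mod 4 = 1 \<longrightarrow>
      card (T1_split h) = (q - 1) div 4 \<and> good 3 ((q - 1) div 4) h)"
proof -
  have "(2 :: 'a) \<noteq> 0"
  proof
    assume "(2 :: 'a) = 0"
    then have "CHAR('a) dvd 2" using of_nat_eq_0_iff_char_dvd[of 2, where 'a = 'a] by simp
    then have "CHAR('a) = 2" using two_is_prime_nat CHAR_not_1[where 'a = 'a] by (auto simp: prime_nat_iff)
    with CHAR_dvd_CARD[where 'a = 'a] show False using assms(1,2) by simp
  qed
  then interpret finite_quartic d
    using assms(3) by unfold_locales
  have h: "h = quartic.h d"
    using assms(4) unfolding h_eq by (simp add: Let_def)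
  show ?thesis
    using galois card_T1_split_h card_split_values_mod good_h assms(1)
    unfolding h split_values_def by auto
qed

end
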